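(* Let $\Gamma$ be the framework given by the $1$-skeleton of a regular polytope (convex or star) in $\mathbb{R}^N$ ($N\ge2$) whose centre is the origin. Embed $\mathbb{R}^N$ in $\mathbb{R}^{N+1}$ as $\{y_{N+1}=0\}$ and, for $b>0$, let the double cone on $\Gamma$ of height $b$ be the framework in $\mathbb{R}^{N+1}$ obtained from $\Gamma$ by adding the two vertices $(0,\dots,0,\pm b)$ and an edge from each of them to each vertex of the polytope. Then there is exactly one $b>0$ for which the double cone on $\Gamma$ of height $b$ is an invariant framework.
   Context: A framework in $\mathbb{R}^M$ is a finite simple graph $(V,E)$ together with an assignment of a point $\vec x\in\mathbb{R}^M$ to each vertex, edges being straight segments. Let $P:\mathbb{R}^M\to\mathbb{C}$, $P(y_1,\dots,y_M)=y_1+iy_2$. The framework is invariant if there is a function $\gamma:V\to\mathbb{R}$ such that for every orthogonal transformation $A$ of $\mathbb{R}^M$, the function $\phi_A(x)=P(A\vec x)$ satisfies equation (1) at every vertex $x$ with this $\gamma$, where equation (1) at $x$ of degree $n(x)$ reads $\frac{\gamma(x)}{n(x)}\big(\sum_{y\sim x}(\phi(y)-\phi(x))\big)^2=\sum_{y\sim x}(\phi(x)-\phi(y))^2$. *)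

theory Defs
  imports "HOL-Analysis.Analysis"
begin

text \<open>A polytope in R^N is represented by the set P of its faces, each face
being identified with its (finite) set of vertices. Faces are ordered by
inclusion; the rank of a face is the affine dimension of its vertex set
(the empty face has rank -1, the polytope itself rank N).\<close>

definition is_chain :: "'a set set \<Rightarrow> bool" where
  "is_chain C \<longleftrightarrow> (\<forall>F\<in>C. \<forall>G\<in>C. F \<subseteq> G \<or> G \<subseteq> F)"

definition flag :: "'a set set \<Rightarrow> 'a set set \<Rightarrow> bool" where
  "flag P \<Phi> \<longleftrightarrow> \<Phi> \<subseteq> P \<and> is_chain \<Phi> \<and>
     (\<forall>\<Psi>. \<Psi> \<subseteq> P \<and> is_chain \<Psi> \<and> \<Phi> \<subseteq> \<Psi> \<longrightarrow> \<Psi> = \<Phi>)"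

definition adjacent_flags :: "'a set set \<Rightarrow> 'a set set \<Rightarrow> 'a set set \<Rightarrow> bool" where
  "adjacent_flags P \<Phi> \<Psi> \<longleftrightarrow> flag P \<Phi> \<and> flag P \<Psi> \<and> card (\<Phi> - \<Psi>) = 1"

text \<open>Abstract polytope of rank DIM('a), realised in 'a with faces given by
vertex sets: finite, least face (empty) and greatest face, rank function
strictly monotone and every flag meeting every rank -1..N, diamond
condition, strong flag-connectivity.\<close>

definition geometric_polytope :: "('a::euclidean_space) set set \<Rightarrow> bool" where
  "geometric_polytope P \<longleftrightarrow>
     finite P \<and> (\<forall>F\<in>P. finite F) \<and>
     {} \<in> P \<and> \<Union>P \<in> P \<and> aff_dim (\<Union>P) = int DIM('a) \<and>
     (\<forall>v\<in>\<Union>P. {v} \<in> P) \<and>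
     (\<forall>F\<in>P. \<forall>G\<in>P. F \<subset> G \<longrightarrow> aff_dim F < aff_dim G) \<and>
     (\<forall>\<Phi>. flag P \<Phi> \<longrightarrow> aff_dim ` \<Phi> = {-1 .. int DIM('a)}) \<and>
     (\<forall>F\<in>P. \<forall>G\<in>P. F \<subseteq> G \<and> aff_dim G = aff_dim F + 2 \<longrightarrow>
        card {H\<in>P. F \<subset> H \<and> H \<subset> G} = 2) \<and>
     (\<forall>\<Phi> \<Psi>. flag P \<Phi> \<and> flag P \<Psi> \<longrightarrow>
        (\<lambda>A B. adjacent_flags P A B \<and> \<Phi> \<inter> \<Psi> \<subseteq> A \<and> \<Phi> \<inter> \<Psi> \<subseteq> B)\<^sup>*\<^sup>* \<Phi> \<Psi>)"

definition regular_polytope_centred :: "('a::euclidean_space) set set \<Rightarrow> bool" where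
  "regular_polytope_centred P \<longleftrightarrow> geometric_polytope P \<and>
     (\<Sum>v\<in>\<Union>P. v) = 0 \<and>
     (\<forall>\<Phi> \<Psi>. flag P \<Phi> \<and> flag P \<Psi> \<longrightarrow>
        (\<exists>A. orthogonal_transformation A \<and> (\<lambda>F. A ` F) ` P = P \<and> (\<lambda>F. A ` F) ` \<Phi> = \<Psi>))"

definition skeleton_edge :: "('a::euclidean_space) set set \<Rightarrow> 'a \<Rightarrow> 'a \<Rightarrow> bool" where
  "skeleton_edge P u v \<longleftrightarrow> u \<noteq> v \<and> {u, v} \<in> P \<and> aff_dim {u, v} = 1"

definition Pc :: "real^('m::{finite,enum}) \<Rightarrow> complex" where
  "Pc y = Complex (y $ (enum_class.enum ! 0)) (y $ (enum_class.enum ! 1))"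

text \<open>A framework whose vertices sit at distinct points: vertex set X
(points of R^M) and a symmetric adjacency relation E.\<close>

definition invariant_framework :: "(real^('m::{finite,enum})) set \<Rightarrow> (real^('m::{finite,enum}) \<Rightarrow> real^('m::{finite,enum}) \<Rightarrow> bool) \<Rightarrow> bool" where
  "invariant_framework X E \<longleftrightarrow>
     (\<exists>\<gamma>. \<forall>A :: real^('m::{finite,enum}) \<Rightarrow> real^('m::{finite,enum}). orthogonal_transformation A \<longrightarrow>
        (\<forall>x\<in>X. let \<phi> = (\<lambda>v. Pc (A v)); Nb = {y\<in>X. E x y}; n = card Nb in
           complex_of_real (\<gamma> x / real n) * (\<Sum>y\<in>Nb. \<phi> y - \<phi> x)\<^sup>2
             = (\<Sum>y\<in>Nb. (\<phi> x - \<phi> y)\<^sup>2)))"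

definition embed_hyp :: "real^('n::finite) \<Rightarrow> real^(('n::finite) + unit)" where
  "embed_hyp u = (\<chi> i. case i of Inl j \<Rightarrow> u $ j | Inr _ \<Rightarrow> 0)"

definition apex :: "real \<Rightarrow> real^(('n::finite) + unit)" where
  "apex c = (\<chi> i. case i of Inl _ \<Rightarrow> 0 | Inr _ \<Rightarrow> c)"

definition cone_vertices :: "(real^('n::finite)) set set \<Rightarrow> real \<Rightarrow> (real^(('n::finite) + unit)) set" where
  "cone_vertices P b = embed_hyp ` (\<Union>P) \<union> {apex b, apex (- b)}"

definition cone_edge :: "(real^('n::finite)) set set \<Rightarrow> real \<Rightarrow> real^(('n::finite) + unit) \<Rightarrow> real^(('n::finite) + unit) \<Rightarrow> bool" where
  "cone_edge P b x y \<longleftrightarrow>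
     (\<exists>u v. x = embed_hyp u \<and> y = embed_hyp v \<and> skeleton_edge P u v) \<or>
     (x \<in> {apex b, apex (- b)} \<and> y \<in> embed_hyp ` (\<Union>P)) \<or>
     (y \<in> {apex b, apex (- b)} \<and> x \<in> embed_hyp ` (\<Union>P))"

end

theory Submission
  imports Defs
begin

text \<open>The invariance equation at \<open>x\<close> says that \<open>\<Sum>w w\<^sup>T - (\<gamma>/n) s s\<^sup>T\<close> is a scalar matrix, where \<open>w\<close> runs over
  the edge vectors at \<open>x\<close> and \<open>s\<close> is their sum. Flag transitivity makes the stabiliser of a vertex \<open>v\<close> contain the
  reflections exchanging two consecutive edges at \<open>v\<close>, and the roots of these reflections span the orthogonal complement of \<open>v\<close>.
  Hence \<open>\<Sum>w w\<^sup>T\<close> over the polytope edges at \<open>v\<close> is \<open>c I + k v v\<^sup>T\<close> with \<open>c > 0\<close> independent of \<open>v\<close>,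
  and \<open>\<Sum>v v\<^sup>T\<close> over all vertices is scalar. At an apex a suitable \<open>\<gamma>\<close> always exists; at a vertex \<open>v\<close>
  one can choose \<open>\<gamma>\<close> to absorb the \<open>v v\<^sup>T\<close> part, and what remains is \<open>2 b\<^sup>2 = c\<close>.\<close>

section \<open>Flags and symmetries of a regular polytope\<close>

text \<open>For an orthonormal pair a, b and the quadratic form Q of the matrix in question, the
  equation at a point reads Q(a,a) - Q(b,b) + 2i Q(a,b) = 0; letting the pair vary leaves only
  scalar matrices. At a polytope vertex v the two edges to the apexes add 2 v v^T and the value 2
  b^2 on the axis, their mixed terms cancelling, while s is a nonzero multiple of v. So \<gamma>
  acts only on the direction of v, a horizontal direction orthogonal to v sees c, the axis sees 2
  b^2, and these two values must agree; N >= 2 provides such a direction.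

  The difficulty lies in the reflections. Star polytopes allow no appeal to convexity: the polytope
  enters only through its faces and its isometries. Flag transitivity yields an isometry that
  exchanges two edges, but says nothing about its action away from the plane of these edges. That it
  is the identity on the orthogonal complement of that plane has to be extracted from the
  combinatorics of flags.\<close>

definition face_at :: "'a::euclidean_space set set \<Rightarrow> int \<Rightarrow> 'a set" where
  "face_at \<Phi> i = (THE F. F \<in> \<Phi> \<and> aff_dim F = i)"

locale regular_polytope =
  fixes P :: "'a::euclidean_space set set"
  assumes regular: "regular_polytope_centred P"
    and dim_ge_2: "2 \<le> DIM('a)"
begin

definition opposite :: "'a set \<Rightarrow> 'a set \<Rightarrow> 'a set \<Rightarrow> 'a set" where
  "opposite L F U = (THE H. H \<in> P \<and> L \<subset> H \<and> H \<subset> U \<and> H \<noteq> F)"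

definition opp :: "'a set set \<Rightarrow> int \<Rightarrow> 'a set" where
  "opp \<Phi> i = opposite (face_at \<Phi> (i - 1)) (face_at \<Phi> i) (face_at \<Phi> (i + 1))"

text \<open>In the language of abstract polytopes this is the i-adjacent flag. It is meaningful for
  0 <= i < N, where the diamond condition makes \<open>opp\<close> well defined.\<close>

definition exchange :: "'a set set \<Rightarrow> int \<Rightarrow> 'a set set" where
  "exchange \<Phi> i = insert (opp \<Phi> i) (\<Phi> - {face_at \<Phi> i})"

definition symmetry :: "('a \<Rightarrow> 'a) \<Rightarrow> bool" where
  "symmetry g \<longleftrightarrow> orthogonal_transformation g \<and> (\<lambda>F. g ` F) ` P = P"

definition nbrs :: "'a \<Rightarrow> 'a set" where
  "nbrs v = {u. skeleton_edge P v u}"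

lemma polytope: "geometric_polytope P"
  using regular by (simp add: regular_polytope_centred_def)

lemma finite_faces: "finite P"
  and finite_face: "F \<in> P \<Longrightarrow> finite F"
  and empty_face: "{} \<in> P"
  and top_face: "\<Union>P \<in> P"
  and aff_dim_top: "aff_dim (\<Union>P) = int DIM('a)"
  and vertex_face: "v \<in> \<Union>P \<Longrightarrow> {v} \<in> P"
  and face_less: "F \<in> P \<Longrightarrow> G \<in> P \<Longrightarrow> F \<subset> G \<Longrightarrow> aff_dim F < aff_dim G"
  and flag_ranks: "flag P \<Phi> \<Longrightarrow> aff_dim ` \<Phi> = {-1 .. int DIM('a)}"
  and diamond: "F \<in> P \<Longrightarrow> G \<in> P \<Longrightarrow> F \<subseteq> G \<Longrightarrow> aff_dim G = aff_dim F + 2 \<Longrightarrow>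
        card {H\<in>P. F \<subset> H \<and> H \<subset> G} = 2"
  and connected: "flag P \<Phi> \<Longrightarrow> flag P \<Psi> \<Longrightarrow>
        (\<lambda>A B. adjacent_flags P A B \<and> \<Phi> \<inter> \<Psi> \<subseteq> A \<and> \<Phi> \<inter> \<Psi> \<subseteq> B)\<^sup>*\<^sup>* \<Phi> \<Psi>"
  using polytope by (simp_all only: geometric_polytope_def simp_thms)

lemma finite_vertices: "finite (\<Union>P)"
  by (rule finite_face[OF top_face])

lemma sum_vertices: "(\<Sum>v\<in>\<Union>P. v) = 0"
  using regular by (simp add: regular_polytope_centred_def)

section \<open>Flags as sequences with one face of each rank\<close>

lemma chain_extends_to_flag:
  assumes "C \<subseteq> P" "is_chain C"
  obtains \<Phi> where "flag P \<Phi>" "C \<subseteq> \<Phi>"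
proof -
  let ?S = "{\<Psi>. \<Psi> \<subseteq> P \<and> is_chain \<Psi>}"
  have "finite ?S" using finite_faces by simp
  from finite_has_maximal2[OF this, of C] assms
  obtain M where "M \<in> ?S" "C \<subseteq> M" "\<forall>b\<in>?S. M \<subseteq> b \<longrightarrow> M = b" by blast
  then have "flag P M" unfolding flag_def by blast
  with \<open>C \<subseteq> M\<close> that show ?thesis by blast
qed

lemma flag_subset: "flag P \<Phi> \<Longrightarrow> \<Phi> \<subseteq> P"
  by (simp add: flag_def)

lemma flag_linear: "flag P \<Phi> \<Longrightarrow> F \<in> \<Phi> \<Longrightarrow> G \<in> \<Phi> \<Longrightarrow> F \<subseteq> G \<or> G \<subseteq> F"
  by (auto simp: flag_def is_chain_def)

lemma chain_rank_inj:
  assumes "C \<subseteq> P" "is_chain C" "F \<in> C" "G \<in> C" "aff_dim F = aff_dim G"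
  shows "F = G"
proof -
  have "F \<in> P" "G \<in> P" "F \<subseteq> G \<or> G \<subseteq> F"
    using assms by (auto simp: is_chain_def)
  then show ?thesis using face_less[of F G] face_less[of G F] assms(5) by auto
qed

lemma flag_rank_inj:
  assumes "flag P \<Phi>" "F \<in> \<Phi>" "G \<in> \<Phi>" "aff_dim F = aff_dim G"
  shows "F = G"
  using assms chain_rank_inj by (auto simp: flag_def)

lemma face_at_eq:
  assumes "flag P \<Phi>" "F \<in> \<Phi>" "aff_dim F = i"
  shows "face_at \<Phi> i = F"
  unfolding face_at_def using assms flag_rank_inj by (intro the_equality) auto

lemma face_at:
  assumes "flag P \<Phi>" "-1 \<le> i" "i \<le> int DIM('a)"
  shows "face_at \<Phi> i \<in> \<Phi>" "aff_dim (face_at \<Phi> i) = i" "face_at \<Phi> i \<in> P"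
proof -
  have "i \<in> aff_dim ` \<Phi>" using flag_ranks[OF assms(1)] assms by auto
  then obtain F where "F \<in> \<Phi>" "aff_dim F = i" by auto
  then show "face_at \<Phi> i \<in> \<Phi>" "aff_dim (face_at \<Phi> i) = i" "face_at \<Phi> i \<in> P"
    using face_at_eq[OF assms(1)] flag_subset[OF assms(1)] by auto
qed

lemma face_at_mono:
  assumes "flag P \<Phi>" "-1 \<le> i" "i \<le> j" "j \<le> int DIM('a)"
  shows "face_at \<Phi> i \<subseteq> face_at \<Phi> j"
proof (cases "i = j")
  case False
  have i: "face_at \<Phi> i \<in> \<Phi>" "aff_dim (face_at \<Phi> i) = i"
    and j: "face_at \<Phi> j \<in> \<Phi>" "aff_dim (face_at \<Phi> j) = j"
    using face_at assms by auto
  show ?thesis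
    using flag_linear[OF assms(1) i(1) j(1)] aff_dim_subset[of "face_at \<Phi> j" "face_at \<Phi> i"]
      i j assms False by auto
qed simp

lemma face_at_strict_mono:
  assumes "flag P \<Phi>" "-1 \<le> i" "i < j" "j \<le> int DIM('a)"
  shows "face_at \<Phi> i \<subset> face_at \<Phi> j"
proof -
  have "face_at \<Phi> i \<noteq> face_at \<Phi> j"
    using face_at(2)[of \<Phi> i] face_at(2)[of \<Phi> j] assms by force
  then show ?thesis using face_at_mono[of \<Phi> i j] assms by auto
qed

lemma flag_eq_image: "flag P \<Phi> \<Longrightarrow> \<Phi> = face_at \<Phi> ` {-1 .. int DIM('a)}"
proof -
  assume f: "flag P \<Phi>"
  have "F \<in> face_at \<Phi> ` {-1 .. int DIM('a)}" if "F \<in> \<Phi>" for F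
    using face_at_eq[OF f that refl] flag_ranks[OF f] imageI[OF that, of aff_dim] by force
  moreover have "face_at \<Phi> i \<in> \<Phi>" if "i \<in> {-1 .. int DIM('a)}" for i
    using face_at(1)[OF f] that by auto
  ultimately show ?thesis by blast
qed

lemma flag_eqI:
  assumes "flag P \<Phi>" "flag P \<Psi>" "\<And>i. -1 \<le> i \<Longrightarrow> i \<le> int DIM('a) \<Longrightarrow> face_at \<Phi> i = face_at \<Psi> i"
  shows "\<Phi> = \<Psi>"
proof -
  have "face_at \<Phi> ` {-1 .. int DIM('a)} = face_at \<Psi> ` {-1 .. int DIM('a)}"
    using assms(3) by (intro image_cong) auto
  then show ?thesis using flag_eq_image assms(1,2) by metis
qed

text \<open>Affine dimensions lie between -1 and N, so a chain realising all of them is maximal: a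
  further face would share its rank with a comparable one.\<close>

lemma flagI:
  assumes "C \<subseteq> P" "is_chain C" "{-1 .. int DIM('a)} \<subseteq> aff_dim ` C"
  shows "flag P C"
proof -
  have "\<Psi> = C" if "\<Psi> \<subseteq> P" "is_chain \<Psi>" "C \<subseteq> \<Psi>" for \<Psi>
  proof -
    have "F \<in> C" if "F \<in> \<Psi>" for F
    proof -
      have "aff_dim F \<in> {-1 .. int DIM('a)}" by (simp add: aff_dim_geq aff_dim_le_DIM)
      then have "aff_dim F \<in> aff_dim ` C" using assms(3) by blast
      then obtain G where "G \<in> C" "aff_dim G = aff_dim F" by auto
      with \<open>F \<in> \<Psi>\<close> \<open>C \<subseteq> \<Psi>\<close> chain_rank_inj[of \<Psi> G F] \<open>\<Psi> \<subseteq> P\<close> \<open>is_chain \<Psi>\<close> show ?thesis by auto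
    qed
    then show ?thesis using that by blast
  qed
  then show ?thesis unfolding flag_def using assms by blast
qed

lemma face_at_bot: "flag P \<Phi> \<Longrightarrow> face_at \<Phi> (-1) = {}"
  using face_at(2)[of \<Phi> "-1"] by (simp add: aff_dim_empty)

lemma face_at_top: 
  assumes "flag P \<Phi>" shows "face_at \<Phi> (int DIM('a)) = \<Union>P"
proof -
  have "face_at \<Phi> (int DIM('a)) \<in> P" "aff_dim (face_at \<Phi> (int DIM('a))) = int DIM('a)"
    using face_at[OF assms] by auto
  then show ?thesis
    using face_less[of "face_at \<Phi> (int DIM('a))" "\<Union>P"] top_face aff_dim_top by fastforce
qed

section \<open>Exchanging one face of a flag\<close>

lemma opposite_ex1:
  assumes "L \<in> P" "U \<in> P" "F \<in> P" "L \<subset> F" "F \<subset> U" "aff_dim U = aff_dim L + 2"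
  shows "\<exists>!H. H \<in> P \<and> L \<subset> H \<and> H \<subset> U \<and> H \<noteq> F"
proof -
  let ?S = "{H\<in>P. L \<subset> H \<and> H \<subset> U}"
  have "card ?S = 2" using diamond assms by blast
  moreover have "F \<in> ?S" using assms by blast
  ultimately have "card (?S - {F}) = 1" by simp
  then obtain H where "?S - {F} = {H}" by (meson card_1_singletonE)
  then have "\<And>K. K \<in> ?S - {F} \<longleftrightarrow> K = H" by simp
  then show ?thesis by (intro ex1I[of _ H]) auto
qed

lemma opp_ex1:
  assumes "flag P \<Phi>" "0 \<le> i" "i < int DIM('a)"
  shows "\<exists>!H. H \<in> P \<and> face_at \<Phi> (i - 1) \<subset> H \<and> H \<subset> face_at \<Phi> (i + 1) \<and> H \<noteq> face_at \<Phi> i"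
  using assms face_at_strict_mono[OF assms(1), of "i - 1" i] face_at_strict_mono[OF assms(1), of i "i + 1"]
  by (intro opposite_ex1) (simp_all add: face_at)

lemma opp:
  assumes "flag P \<Phi>" "0 \<le> i" "i < int DIM('a)"
  shows "opp \<Phi> i \<in> P" "face_at \<Phi> (i - 1) \<subset> opp \<Phi> i" "opp \<Phi> i \<subset> face_at \<Phi> (i + 1)"
    "opp \<Phi> i \<noteq> face_at \<Phi> i"
  using theI'[OF opp_ex1[OF assms]] unfolding opp_def opposite_def by blast+

lemma opp_unique:
  assumes "flag P \<Phi>" "0 \<le> i" "i < int DIM('a)"
    "H \<in> P" "face_at \<Phi> (i - 1) \<subset> H" "H \<subset> face_at \<Phi> (i + 1)" "H \<noteq> face_at \<Phi> i"
  shows "opp \<Phi> i = H"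
  unfolding opp_def opposite_def
  by (rule the1_equality[OF opp_ex1[OF assms(1-3)]]) (intro conjI assms(4-))

lemma aff_dim_opp:
  assumes "flag P \<Phi>" "0 \<le> i" "i < int DIM('a)"
  shows "aff_dim (opp \<Phi> i) = i"
proof -
  have "i - 1 < aff_dim (opp \<Phi> i)"
    using face_less[OF _ _ opp(2)[OF assms]] opp(1)[OF assms] face_at[OF assms(1), of "i-1"] assms by auto
  moreover have "aff_dim (opp \<Phi> i) < i + 1"
    using face_less[OF _ _ opp(3)[OF assms]] opp(1)[OF assms] face_at[OF assms(1), of "i+1"] assms by auto
  ultimately show ?thesis by simp
qed

lemma flag_exchange:
  assumes "flag P \<Phi>" "0 \<le> i" "i < int DIM('a)"
  shows "flag P (exchange \<Phi> i)"
proof (rule flagI)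
  show "exchange \<Phi> i \<subseteq> P" using opp(1)[OF assms] flag_subset[OF assms(1)] by (auto simp: exchange_def)
  have cmp: "opp \<Phi> i \<subseteq> F \<or> F \<subseteq> opp \<Phi> i" if F: "F \<in> \<Phi>" "F \<noteq> face_at \<Phi> i" for F
  proof -
    obtain k where k: "-1 \<le> k" "k \<le> int DIM('a)" "F = face_at \<Phi> k"
    proof -
      have "F \<in> face_at \<Phi> ` {-1 .. int DIM('a)}" using flag_eq_image[OF assms(1)] F(1) by blast
      then show ?thesis using that by auto
    qed
    then have "k \<noteq> i" using F by auto
    then consider "k \<le> i - 1" | "i + 1 \<le> k" by linarith
    then show ?thesis
    proof cases
      case 1
      then have "F \<subseteq> face_at \<Phi> (i - 1)" using face_at_mono[OF assms(1)] k assms by auto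
      then show ?thesis using opp(2)[OF assms] by blast
    next
      case 2
      then have "face_at \<Phi> (i + 1) \<subseteq> F" using face_at_mono[OF assms(1)] k assms by auto
      then show ?thesis using opp(3)[OF assms] by blast
    qed
  qed
  show "is_chain (exchange \<Phi> i)"
    unfolding is_chain_def exchange_def using cmp flag_linear[OF assms(1)] by blast
  show "{-1..int DIM('a)} \<subseteq> aff_dim ` exchange \<Phi> i"
  proof
    fix k assume k: "k \<in> {-1..int DIM('a)}"
    show "k \<in> aff_dim ` exchange \<Phi> i"
    proof (cases "k = i")
      case True
      then show ?thesis using aff_dim_opp[OF assms] by (auto simp: exchange_def)
    next
      case False
      have "face_at \<Phi> k \<noteq> face_at \<Phi> i" using face_at(2)[OF assms(1), of k] face_at(2)[OF assms(1), of i] k assms False by auto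
      moreover have "face_at \<Phi> k \<in> \<Phi>" "aff_dim (face_at \<Phi> k) = k" using face_at[OF assms(1)] k by auto
      ultimately have "face_at \<Phi> k \<in> exchange \<Phi> i" by (simp add: exchange_def)
      then show ?thesis using \<open>aff_dim (face_at \<Phi> k) = k\<close> by force
    qed
  qed
qed

lemma face_at_exchange:
  assumes "flag P \<Phi>" "0 \<le> i" "i < int DIM('a)" "-1 \<le> k" "k \<le> int DIM('a)"
  shows "face_at (exchange \<Phi> i) k = (if k = i then opp \<Phi> i else face_at \<Phi> k)"
proof (cases "k = i")
  case True
  then show ?thesis using face_at_eq[OF flag_exchange[OF assms(1-3)], of "opp \<Phi> i" i] aff_dim_opp[OF assms(1-3)]
    by (simp add: exchange_def)
next
  case False
  have k: "face_at \<Phi> k \<in> \<Phi>" "aff_dim (face_at \<Phi> k) = k" using face_at[OF assms(1)] assms by auto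
  have "aff_dim (face_at \<Phi> i) = i" using face_at(2)[OF assms(1)] assms by simp
  then have "face_at \<Phi> k \<noteq> face_at \<Phi> i" using False k(2) by metis
  then have "face_at \<Phi> k \<in> exchange \<Phi> i" using k(1) by (simp add: exchange_def)
  then show ?thesis using face_at_eq[OF flag_exchange[OF assms(1-3)] _ k(2)] False by auto
qed

text \<open>Adjacency is defined by a cardinality only. The face that changes is neither the least
  nor the greatest one, since every flag contains both, and the diamond condition identifies its
  replacement.\<close>

lemma adjacent_imp_exchange:
  assumes "adjacent_flags P A B"
  obtains i where "0 \<le> i" "i < int DIM('a)" "B = exchange A i"
proof -
  have A: "flag P A" and B: "flag P B" and "card (A - B) = 1"
    using assms by (auto simp: adjacent_flags_def)
  then obtain F where F: "A - B = {F}" by (meson card_1_singletonE)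
  define i where "i = aff_dim F"
  have FA: "F \<in> A" "F \<notin> B" using F by auto
  have Fi: "F = face_at A i" using face_at_eq[OF A FA(1)] i_def by simp
  have ir: "-1 \<le> i" "i \<le> int DIM('a)" by (simp_all add: i_def aff_dim_geq aff_dim_le_DIM)
  have "i \<noteq> -1" using Fi face_at_bot[OF A] face_at_bot[OF B] face_at(1)[OF B, of "-1"] FA by auto
  moreover have "i \<noteq> int DIM('a)" using Fi face_at_top[OF A] face_at_top[OF B] face_at(1)[OF B, of "int DIM('a)"] FA by auto
  ultimately have i: "0 \<le> i" "i < int DIM('a)" using ir by auto
  have same: "face_at B k = face_at A k" if "-1 \<le> k" "k \<le> int DIM('a)" "k \<noteq> i" for k
  proof -
    have k: "face_at A k \<in> A" "aff_dim (face_at A k) = k" using face_at[OF A] that by auto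
    then have "face_at A k \<noteq> F" using that(3) i_def by auto
    then have "face_at A k \<in> B" using F k(1) by blast
    then show ?thesis using face_at_eq[OF B _ k(2)] by simp
  qed
  have ne: "face_at B i \<noteq> face_at A i" using Fi FA face_at(1)[OF B ir] by auto
  have "opp A i = face_at B i"
  proof (rule opp_unique[OF A i _ _ _ ne])
    show "face_at B i \<in> P" using face_at[OF B ir] by auto
    show "face_at A (i - 1) \<subset> face_at B i"
      using face_at_strict_mono[OF B, of "i-1" i] same[of "i-1"] i by auto
    show "face_at B i \<subset> face_at A (i + 1)"
      using face_at_strict_mono[OF B, of i "i+1"] same[of "i+1"] i by auto
  qed
  then have "B = exchange A i"
    by (intro flag_eqI[OF B flag_exchange[OF A i]]) (auto simp: face_at_exchange[OF A i] same)
  then show ?thesis using that i by blast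
qed

text \<open>Strong connectedness as an induction rule: one face changes at a time, and the faces
  common to both end flags survive throughout. Keeping them is what allows arguments confined to the
  flags through one vertex.\<close>

lemma flag_induct [consumes 2, case_names start step]:
  assumes "flag P \<Phi>" "flag P \<Psi>" "Q \<Phi>"
    and step: "\<And>A i. flag P A \<Longrightarrow> 0 \<le> i \<Longrightarrow> i < int DIM('a) \<Longrightarrow> \<Phi> \<inter> \<Psi> \<subseteq> A \<Longrightarrow>
      \<Phi> \<inter> \<Psi> \<subseteq> exchange A i \<Longrightarrow> Q A \<Longrightarrow> Q (exchange A i)"
  shows "Q \<Psi>"
  using connected[OF assms(1,2)]
proof (induction rule: rtranclp_induct)
  case base show ?case by fact
next
  case (step A B)
  then obtain i where "0 \<le> i" "i < int DIM('a)" "B = exchange A i" using adjacent_imp_exchange by blast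
  moreover have "flag P A" using step by (auto simp: adjacent_flags_def)
  ultimately show ?case using assms(4)[of A i] step by auto
qed

end

text \<open>Turns containment in an affine hull into containment of direction spaces seen from
  \<open>v\<close>, on which symmetries fixing \<open>v\<close> act linearly.\<close>

lemma dir_span_subset:
  fixes v :: "'a::euclidean_space"
  assumes "v \<in> T" "S \<subseteq> affine hull T"
  shows "(\<lambda>w. w - v) ` S \<subseteq> span ((\<lambda>w. w - v) ` T)"
proof -
  have "affine hull T = (\<lambda>x. v + x) ` span ((\<lambda>x. -v + x) ` T)"
    by (rule affine_hull_span_gen) (rule hull_inc[OF assms(1)])
  then have "S \<subseteq> (\<lambda>x. v + x) ` span ((\<lambda>w. w - v) ` T)"
    using assms(2) by (simp only: uminus_add_conv_diff)
  then show ?thesis by auto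
qed

lemma orthogonal_transformation_inner:
  "orthogonal_transformation g \<Longrightarrow> g x \<bullet> g y = x \<bullet> y"
  by (simp add: orthogonal_transformation_def)

context regular_polytope
begin

section \<open>Symmetries and their action on flags\<close>

lemma symmetry_linear: "symmetry g \<Longrightarrow> linear g"
  and symmetry_inj: "symmetry g \<Longrightarrow> inj g"
  and symmetry_inner: "symmetry g \<Longrightarrow> g x \<bullet> g y = x \<bullet> y"
  and symmetry_surj: "symmetry g \<Longrightarrow> surj g"
  by (auto simp: symmetry_def orthogonal_transformation_linear orthogonal_transformation_inj
      orthogonal_transformation_inner orthogonal_transformation_surj)

lemma symmetry_norm: "symmetry g \<Longrightarrow> norm (g x) = norm x"
  by (simp add: symmetry_def orthogonal_transformation_norm)

lemma symmetry_diff: "symmetry g \<Longrightarrow> g (x - y) = g x - g y"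
  by (simp add: linear_diff symmetry_linear)

lemma symmetry_compose: "symmetry g \<Longrightarrow> symmetry h \<Longrightarrow> symmetry (g \<circ> h)"
proof -
  assume g: "symmetry g" and h: "symmetry h"
  have "(\<lambda>F. (g \<circ> h) ` F) ` P = (\<lambda>F. g ` F) ` (\<lambda>F. h ` F) ` P"
    by (simp add: image_image image_comp[symmetric])
  then show ?thesis
    using g h by (simp add: symmetry_def orthogonal_transformation_compose)
qed

lemma symmetry_face: "symmetry g \<Longrightarrow> F \<in> P \<Longrightarrow> g ` F \<in> P"
  unfolding symmetry_def by blast

lemma symmetry_face_iff:
  assumes "symmetry g" shows "g ` F \<in> P \<longleftrightarrow> F \<in> P"
proof
  assume "g ` F \<in> P"
  then have "g ` F \<in> (\<lambda>F. g ` F) ` P" using assms by (simp add: symmetry_def)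
  then obtain G where "G \<in> P" "g ` F = g ` G" by blast
  then show "F \<in> P" using inj_image_eq_iff[OF symmetry_inj[OF assms]] by metis
qed (rule symmetry_face[OF assms])

lemma symmetry_vertices:
  assumes "symmetry g" shows "g ` \<Union>P = \<Union>P"
proof -
  have "g ` \<Union>P = \<Union>((\<lambda>F. g ` F) ` P)" by blast
  then show ?thesis using assms by (simp add: symmetry_def)
qed

lemma symmetry_aff_dim: "symmetry g \<Longrightarrow> aff_dim (g ` F) = aff_dim F"
  by (simp add: symmetry_linear symmetry_inj)

lemma image_psubset_iff: "inj g \<Longrightarrow> g ` A \<subset> g ` B \<longleftrightarrow> A \<subset> B"
  by (simp add: psubset_eq inj_image_subset_iff inj_image_eq_iff)

lemma symmetry_flag:
  assumes g: "symmetry g" and f: "flag P \<Phi>"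
  shows "flag P ((\<lambda>F. g ` F) ` \<Phi>)"
proof (rule flagI)
  show "(\<lambda>F. g ` F) ` \<Phi> \<subseteq> P" using symmetry_face[OF g] flag_subset[OF f] by blast
  show "is_chain ((\<lambda>F. g ` F) ` \<Phi>)" using flag_linear[OF f] unfolding is_chain_def by blast
  show "{- 1..int DIM('a)} \<subseteq> aff_dim ` (\<lambda>F. g ` F) ` \<Phi>"
    using flag_ranks[OF f] by (simp add: image_image symmetry_aff_dim[OF g])
qed

lemma face_at_image:
  assumes "symmetry g" "flag P \<Phi>" "-1 \<le> i" "i \<le> int DIM('a)"
  shows "face_at ((\<lambda>F. g ` F) ` \<Phi>) i = g ` face_at \<Phi> i"
  using face_at_eq[OF symmetry_flag[OF assms(1,2)]] face_at[OF assms(2-4)] symmetry_aff_dim[OF assms(1)]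
  by simp

text \<open>Three consecutive faces determine the opposite one, so the behaviour of \<open>g\<close>
  on these ranks suffices; \<open>g\<close> need not carry the whole of one flag to the
  other.\<close>

lemma image_opp:
  assumes g: "symmetry g" and "flag P \<Phi>" "flag P \<Psi>" "0 \<le> i" "i < int DIM('a)"
    and im: "\<And>k. k \<in> {i - 1, i, i + 1} \<Longrightarrow> g ` face_at \<Phi> k = face_at \<Psi> k"
  shows "g ` opp \<Phi> i = opp \<Psi> i"
proof (rule opp_unique[OF assms(3-5), symmetric])
  note o = opp[OF assms(2,4,5)]
  have e: "face_at \<Psi> (i - 1) = g ` face_at \<Phi> (i - 1)" "face_at \<Psi> i = g ` face_at \<Phi> i"
    "face_at \<Psi> (i + 1) = g ` face_at \<Phi> (i + 1)"
    using im by auto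
  note inj = symmetry_inj[OF g]
  show "g ` opp \<Phi> i \<in> P" using o(1) symmetry_face[OF g] by blast
  show "face_at \<Psi> (i - 1) \<subset> g ` opp \<Phi> i" "g ` opp \<Phi> i \<subset> face_at \<Psi> (i + 1)"
    using o(2,3) by (simp_all add: e image_psubset_iff[OF inj])
  show "g ` opp \<Phi> i \<noteq> face_at \<Psi> i" using o(4) by (simp add: e inj_image_eq_iff[OF inj])
qed

lemma opp_exchange:
  assumes "flag P \<Phi>" "0 \<le> i" "i < int DIM('a)"
  shows "opp (exchange \<Phi> i) i = face_at \<Phi> i"
proof (rule opp_unique[OF flag_exchange[OF assms] assms(2,3)])
  show "face_at \<Phi> i \<in> P" using face_at(3)[OF assms(1)] assms by auto
  show "face_at (exchange \<Phi> i) (i - 1) \<subset> face_at \<Phi> i"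
    "face_at \<Phi> i \<subset> face_at (exchange \<Phi> i) (i + 1)"
    using assms by (simp_all add: face_at_exchange face_at_strict_mono)
  show "face_at \<Phi> i \<noteq> face_at (exchange \<Phi> i) i"
    using opp(4)[OF assms] assms by (simp add: face_at_exchange)
qed

section \<open>Transitivity on flags and vertices, rigidity\<close>

lemma flag_transitive:
  assumes "flag P \<Phi>" "flag P \<Psi>"
  obtains g where "symmetry g" "\<And>i. -1 \<le> i \<Longrightarrow> i \<le> int DIM('a) \<Longrightarrow> g ` face_at \<Phi> i = face_at \<Psi> i"
proof -
  obtain g where g: "orthogonal_transformation g" "(\<lambda>F. g ` F) ` P = P" "(\<lambda>F. g ` F) ` \<Phi> = \<Psi>"
    using regular assms unfolding regular_polytope_centred_def by meson
  then have "symmetry g" by (simp add: symmetry_def)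
  then show ?thesis using that[of g] face_at_image[OF _ assms(1)] g(3) by metis
qed

lemma rank_0_face:
  assumes "flag P \<Phi>" obtains v where "face_at \<Phi> 0 = {v}" "v \<in> \<Union>P"
proof -
  have "aff_dim (face_at \<Phi> 0) = 0" "face_at \<Phi> 0 \<in> P" using face_at[OF assms, of 0] by auto
  moreover then obtain v where "face_at \<Phi> 0 = {v}" using aff_dim_eq_0 by blast
  ultimately show ?thesis using that by (metis UnionI insertI1)
qed

lemma flag_through_vertex:
  assumes "v \<in> F" "F \<in> P"
  obtains \<Phi> where "flag P \<Phi>" "face_at \<Phi> 0 = {v}" "F \<in> \<Phi>"
proof -
  have "{{v}, F} \<subseteq> P" "is_chain {{v}, F}" using assms vertex_face by (auto simp: is_chain_def)
  then obtain \<Phi> where "flag P \<Phi>" "{{v}, F} \<subseteq> \<Phi>" using chain_extends_to_flag by metis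
  then show ?thesis using that face_at_eq[of \<Phi> "{v}" 0] by simp
qed

lemma vertex_transitive:
  assumes "v \<in> \<Union>P" "w \<in> \<Union>P"
  obtains g where "symmetry g" "g v = w"
proof -
  obtain \<Phi> where \<Phi>: "flag P \<Phi>" "face_at \<Phi> 0 = {v}" using flag_through_vertex assms top_face by metis
  obtain \<Psi> where \<Psi>: "flag P \<Psi>" "face_at \<Psi> 0 = {w}" using flag_through_vertex assms top_face by metis
  obtain g where "symmetry g" "\<And>i. -1 \<le> i \<Longrightarrow> i \<le> int DIM('a) \<Longrightarrow> g ` face_at \<Phi> i = face_at \<Psi> i"
    using flag_transitive[OF \<Phi>(1) \<Psi>(1)] by metis
  then have "symmetry g" "g ` {v} = {w}" using \<Phi>(2) \<Psi>(2) by (simp, metis neg_le_0_iff_le of_nat_0_le_iff zero_le_one)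
  then show ?thesis using that[of g] by simp
qed

lemma norm_vertices: "v \<in> \<Union>P \<Longrightarrow> w \<in> \<Union>P \<Longrightarrow> norm v = norm w"
  by (metis vertex_transitive symmetry_norm)

lemma span_vertices: "span (\<Union>P) = UNIV"
proof -
  have "affine hull (\<Union>P) = UNIV" using aff_dim_top aff_dim_eq_full by blast
  then show ?thesis using affine_hull_subset_span[of "\<Union>P"] by auto
qed

lemma vertices_nonempty: "\<Union>P \<noteq> {}"
  using aff_dim_top by (metis aff_dim_empty_eq of_nat_less_0_iff neg_less_0_iff_less zero_less_one)

lemma vertex_nonzero: assumes "v \<in> \<Union>P" shows "v \<noteq> 0"
proof
  assume "v = 0"
  then have "\<Union>P \<subseteq> {0}" using norm_vertices[OF assms] by fastforce
  then have "aff_dim (\<Union>P) \<le> 0" using aff_dim_subset[of "\<Union>P" "{0}"] by simp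
  then show False using aff_dim_top dim_ge_2 by simp
qed

text \<open>Rigidity: agreement on one flag propagates through every exchange by
  \<open>image_opp\<close>, hence reaches all vertices, and these span the space. It serves to show
  that two symmetries commute by looking at a single flag.\<close>

lemma symmetry_eqI:
  assumes g: "symmetry g" and h: "symmetry h" and \<Phi>: "flag P \<Phi>"
    and eq: "\<And>i. -1 \<le> i \<Longrightarrow> i \<le> int DIM('a) \<Longrightarrow> g ` face_at \<Phi> i = h ` face_at \<Phi> i"
  shows "g = h"
proof -
  have all: "\<forall>i. -1 \<le> i \<longrightarrow> i \<le> int DIM('a) \<longrightarrow> g ` face_at \<Psi> i = h ` face_at \<Psi> i" if "flag P \<Psi>" for \<Psi>
    using \<Phi> that
  proof (induction rule: flag_induct)
    case start show ?case using eq by blast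
  next
    case (step A i)
    note hA = symmetry_flag[OF h step(1)]
    have im: "g ` face_at A k = face_at ((\<lambda>F. h ` F) ` A) k" "h ` face_at A k = face_at ((\<lambda>F. h ` F) ` A) k"
      if "k \<in> {i - 1, i, i + 1}" for k
    proof -
      have "-1 \<le> k" "k \<le> int DIM('a)" using that step(2,3) by auto
      then show "g ` face_at A k = face_at ((\<lambda>F. h ` F) ` A) k" "h ` face_at A k = face_at ((\<lambda>F. h ` F) ` A) k"
        using step(6) by (simp_all add: face_at_image[OF h step(1)])
    qed
    have "g ` opp A i = opp ((\<lambda>F. h ` F) ` A) i"
      by (rule image_opp[OF g step(1) hA step(2,3) im(1)])
    also have "\<dots> = h ` opp A i"
      by (rule image_opp[OF h step(1) hA step(2,3) im(2), symmetric])
    finally show ?case using step by (auto simp: face_at_exchange)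
  qed
  have "g v = h v" if v: "v \<in> \<Union>P" for v
  proof -
    obtain \<Psi> where \<Psi>: "flag P \<Psi>" "face_at \<Psi> 0 = {v}" using flag_through_vertex v top_face by metis
    have "g ` {v} = h ` {v}" using all[OF \<Psi>(1), rule_format, of 0] \<Psi>(2) by simp
    then show ?thesis by simp
  qed
  then have "g x = h x" if "x \<in> span (\<Union>P)" for x
    using linear_eq_on_span[OF symmetry_linear[OF g] symmetry_linear[OF h]] that by blast
  then show ?thesis using span_vertices by auto
qed

text \<open>If the affine hull of the opposite face were no larger, flag transitivity and
  connectedness would confine all vertices to the affine hull of a single proper face.\<close>

lemma opp_not_in_affine_hull:
  assumes \<Phi>: "flag P \<Phi>" and j: "0 \<le> j" "j < int DIM('a)"
  shows "\<not> opp \<Phi> j \<subseteq> affine hull (face_at \<Phi> j)"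
proof
  assume sub: "opp \<Phi> j \<subseteq> affine hull (face_at \<Phi> j)"
  have sub': "opp \<Psi> j \<subseteq> affine hull (face_at \<Psi> j)" if \<Psi>: "flag P \<Psi>" for \<Psi>
  proof -
    obtain g where g: "symmetry g" "\<And>i. -1 \<le> i \<Longrightarrow> i \<le> int DIM('a) \<Longrightarrow> g ` face_at \<Phi> i = face_at \<Psi> i"
      using flag_transitive[OF \<Phi> \<Psi>] by metis
    have "opp \<Psi> j = g ` opp \<Phi> j" using j by (intro image_opp[OF g(1) \<Phi> \<Psi>, symmetric] g(2)) auto
    also have "\<dots> \<subseteq> g ` (affine hull (face_at \<Phi> j))" using sub by blast
    also have "\<dots> = affine hull (g ` face_at \<Phi> j)"
      using affine_hull_linear_image symmetry_linear[OF g(1)] linear_conv_bounded_linear by blast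
    finally show ?thesis using g(2)[of j] j by simp
  qed
  have all: "face_at \<Psi> j \<subseteq> affine hull (face_at \<Phi> j)" if "flag P \<Psi>" for \<Psi>
    using \<Phi> that
  proof (induction rule: flag_induct)
    case start show ?case by (simp add: hull_subset)
  next
    case (step A i)
    show ?case
    proof (cases "i = j")
      case True
      then have "face_at (exchange A i) j \<subseteq> affine hull (face_at A j)"
        using sub'[OF step(1)] step j by (simp add: face_at_exchange)
      also have "\<dots> \<subseteq> affine hull (face_at \<Phi> j)" using step(6) by (simp add: hull_minimal)
      finally show ?thesis .
    next
      case False
      then show ?thesis using step j by (simp add: face_at_exchange)
    qed
  qed
  have "\<Union>P \<subseteq> affine hull (face_at \<Phi> j)"
  proof
    fix w assume "w \<in> \<Union>P"
    then obtain \<Psi> where \<Psi>: "flag P \<Psi>" "face_at \<Psi> 0 = {w}" using flag_through_vertex top_face by metis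
    have "face_at \<Psi> 0 \<subseteq> face_at \<Psi> j" using face_at_mono[OF \<Psi>(1)] j by simp
    then show "w \<in> affine hull (face_at \<Phi> j)" using all[OF \<Psi>(1)] \<Psi>(2) by blast
  qed
  then have "aff_dim (\<Union>P) \<le> aff_dim (affine hull (face_at \<Phi> j))" by (rule aff_dim_subset)
  then show False using aff_dim_top face_at(2)[OF \<Phi>, of j] j by simp
qed

text \<open>The opposite face leaves the affine hull of \<open>face_at \<Phi> j\<close>, so together
  the two have dimension above \<open>j\<close>, which is all that the face of rank
  \<open>j + 1\<close> containing them can offer.\<close>

lemma face_in_affine_hull:
  assumes \<Phi>: "flag P \<Phi>" and j: "0 \<le> j" "j < int DIM('a)"
  shows "face_at \<Phi> (j + 1) \<subseteq> affine hull (face_at \<Phi> j \<union> opp \<Phi> j)"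
proof -
  let ?S = "face_at \<Phi> j \<union> opp \<Phi> j" and ?U = "face_at \<Phi> (j + 1)"
  have dims: "aff_dim (face_at \<Phi> j) = j" "aff_dim ?U = j + 1"
    using face_at(2)[OF \<Phi>] j by auto
  have "?S \<subseteq> ?U" using opp(3)[OF \<Phi> j] face_at_mono[OF \<Phi>, of j "j+1"] j by auto
  then have le: "aff_dim ?S \<le> j + 1" using aff_dim_subset dims by metis
  have "affine hull (face_at \<Phi> j) \<subset> affine hull ?S"
    using opp_not_in_affine_hull[OF assms] hull_mono[of "face_at \<Phi> j" ?S affine] hull_subset[of ?S affine] by blast
  then have "aff_dim (face_at \<Phi> j) < aff_dim ?S" by (rule aff_dim_psubset)
  then have "aff_dim ?S = aff_dim ?U" using le dims by linarith
  then have "affine hull ?S = affine hull ?U" using aff_dim_eq_full_gen[OF \<open>?S \<subseteq> ?U\<close>] by simp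
  then show ?thesis using hull_subset by metis
qed

text \<open>Affine dimension 1 alone would allow many collinear vertices; the diamond condition
  above the empty face leaves exactly two.\<close>

lemma edge_card:
  assumes "F \<in> P" "aff_dim F = 1" "v \<in> F"
  obtains u where "u \<noteq> v" "F = {v, u}"
proof -
  have "card {H\<in>P. {} \<subset> H \<and> H \<subset> F} = 2" using assms empty_face by (intro diamond) auto
  moreover have "(\<lambda>v. {v}) ` F \<subseteq> {H\<in>P. {} \<subset> H \<and> H \<subset> F}"
  proof
    fix H assume "H \<in> (\<lambda>v. {v}) ` F"
    then obtain w where w: "w \<in> F" "H = {w}" by blast
    moreover have "F \<noteq> {w}" using assms(2) by auto
    ultimately show "H \<in> {H\<in>P. {} \<subset> H \<and> H \<subset> F}" using vertex_face assms(1) by blast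
  qed
  ultimately have "card ((\<lambda>v. {v}) ` F) \<le> 2"
    using card_mono[of "{H\<in>P. {} \<subset> H \<and> H \<subset> F}"] finite_faces by simp
  then have "card F \<le> 2" by (simp add: card_image)
  moreover have "card F \<ge> 2" using aff_dim_le_card[OF finite_face[OF assms(1)]] assms(2) by simp
  ultimately have "card F = 2" by simp
  then obtain p q where "F = {p, q}" "p \<noteq> q" by (meson card_2_iff)
  then show ?thesis using that[of q] that[of p] assms(3) by auto
qed

lemma nbrs_iff_face: "u \<in> nbrs v \<longleftrightarrow> u \<noteq> v \<and> {v, u} \<in> P"
  by (auto simp: nbrs_def skeleton_edge_def aff_dim_2)

lemma nbrs_subset: "nbrs v \<subseteq> \<Union>P"
  by (auto simp: nbrs_iff_face)

lemma finite_nbrs: "finite (nbrs v)"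
  using finite_subset[OF nbrs_subset finite_vertices] .

lemma flag_edge:
  assumes "flag P \<Phi>" "face_at \<Phi> 0 = {v}"
  obtains u where "face_at \<Phi> 1 = {v, u}" "u \<in> nbrs v"
proof -
  have F: "face_at \<Phi> 1 \<in> P" "aff_dim (face_at \<Phi> 1) = 1" using face_at[OF assms(1), of 1] dim_ge_2 by auto
  have "v \<in> face_at \<Phi> 1" using face_at_mono[OF assms(1), of 0 1] assms dim_ge_2 by simp
  then obtain u where "u \<noteq> v" "face_at \<Phi> 1 = {v, u}" using edge_card[OF F] by metis
  then show ?thesis using that F by (simp add: nbrs_iff_face)
qed

lemma flag_through_edge:
  assumes "u \<in> nbrs v"
  obtains \<Phi> where "flag P \<Phi>" "face_at \<Phi> 0 = {v}" "face_at \<Phi> 1 = {v, u}"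
proof -
  have "u \<noteq> v" "{v, u} \<in> P" using assms by (auto simp: nbrs_iff_face)
  then obtain \<Phi> where \<Phi>: "flag P \<Phi>" "face_at \<Phi> 0 = {v}" "{v, u} \<in> \<Phi>"
    using flag_through_vertex[of v "{v, u}"] by blast
  then show ?thesis using that face_at_eq[OF \<Phi>(1,3), of 1] \<open>u \<noteq> v\<close> by (simp add: aff_dim_2)
qed

lemma nbrs_image:
  assumes "symmetry g" shows "g ` nbrs v = nbrs (g v)"
proof -
  have "g u \<in> nbrs (g v) \<longleftrightarrow> u \<in> nbrs v" for u
    using symmetry_face_iff[OF assms, of "{v, u}"] inj_eq[OF symmetry_inj[OF assms]] by (auto simp: nbrs_iff_face)
  then show ?thesis using symmetry_surj[OF assms] by (auto simp: image_iff) (metis surjD)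
qed

text \<open>A functional that is constant along the edges at \<open>v\<close> is constant on every
  face of a flag through \<open>v\<close>, by induction on the rank: the next face lies in the
  affine hull of two faces of the previous rank, both belonging to flags through
  \<open>v\<close>.\<close>

lemma edges_at_vertex_span:
  assumes v: "v \<in> \<Union>P" and x: "\<And>u. u \<in> nbrs v \<Longrightarrow> x \<bullet> (u - v) = 0"
  shows "x = 0"
proof -
  \<comment> \<open>The flag is kept arbitrary because the induction hypothesis is also applied to
    the flag with its face of rank \<open>j\<close> exchanged, which still starts at
    \<open>v\<close>.\<close>
  have F: "face_at \<Phi> (int j) \<subseteq> {w. x \<bullet> w = x \<bullet> v}"
    if "flag P \<Phi>" "face_at \<Phi> 0 = {v}" "1 \<le> j" "j \<le> DIM('a)" for \<Phi> j
    using that(3,4,1,2)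
  proof (induction j arbitrary: \<Phi> rule: dec_induct)
    case base
    then obtain u where "face_at \<Phi> 1 = {v, u}" "u \<in> nbrs v" using flag_edge by metis
    then show ?case using x[of u] by (simp add: inner_diff_right)
  next
    case (step j)
    have j: "0 \<le> int j" "int j < int DIM('a)" using step by auto
    have "face_at (exchange \<Phi> (int j)) 0 = {v}" "face_at (exchange \<Phi> (int j)) (int j) = opp \<Phi> (int j)"
      using step face_at_exchange[OF step.prems(2) j] by auto
    then have "opp \<Phi> (int j) \<subseteq> {w. x \<bullet> w = x \<bullet> v}"
      using step.IH[OF _ flag_exchange[OF step.prems(2) j]] step.prems by simp
    moreover have "face_at \<Phi> (int j) \<subseteq> {w. x \<bullet> w = x \<bullet> v}" using step by simp
    ultimately have "affine hull (face_at \<Phi> (int j) \<union> opp \<Phi> (int j)) \<subseteq> {w. x \<bullet> w = x \<bullet> v}"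
      by (intro hull_minimal affine_hyperplane) auto
    then show ?case using face_in_affine_hull[OF step.prems(2) j] by (simp add: add.commute)
  qed
  obtain \<Phi> where \<Phi>: "flag P \<Phi>" "face_at \<Phi> 0 = {v}" using flag_through_vertex v top_face by metis
  have const: "x \<bullet> w = x \<bullet> v" if "w \<in> \<Union>P" for w
    using F[OF \<Phi>, of "DIM('a)"] dim_ge_2 face_at_top[OF \<Phi>(1)] that by auto
  \<comment> \<open>The centre is the origin, so the common value on all vertices is zero.\<close>
  have "0 = x \<bullet> (\<Sum>w\<in>\<Union>P. w)" by (simp add: sum_vertices)
  also have "\<dots> = (\<Sum>w\<in>\<Union>P. x \<bullet> w)" by (rule inner_sum_right)
  also have "\<dots> = real (card (\<Union>P)) * (x \<bullet> v)" using const by simp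
  finally have "x \<bullet> v = 0" using finite_vertices v by auto
  then have "orthogonal x w" if "w \<in> \<Union>P" for w using const that by (simp add: orthogonal_def)
  then have "orthogonal x x" using orthogonal_to_span[of x "\<Union>P" x] span_vertices by (metis UNIV_I)
  then show ?thesis by (simp add: orthogonal_def)
qed

end

section \<open>Reflections in the stabiliser of a vertex\<close>

context regular_polytope
begin

text \<open>The combinatorial half of the reflection: a symmetry carrying \<open>\<Phi>\<close> to
  its exchange at rank 1 also carries the opposite edge back, since exchanging twice restores the
  original face.\<close>

lemma vertex_figure_reflection_data:
  assumes \<Phi>: "flag P \<Phi>" and v: "face_at \<Phi> 0 = {v}"
    and p: "face_at \<Phi> 1 = {v, p}" and q: "opp \<Phi> 1 = {v, q}"
  obtains g where "symmetry g" "g v = v" "g p = q" "g q = p"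
    "\<And>i. -1 \<le> i \<Longrightarrow> i \<le> int DIM('a) \<Longrightarrow> i \<noteq> 1 \<Longrightarrow> g ` face_at \<Phi> i = face_at \<Phi> i"
    "g ` face_at \<Phi> 1 = opp \<Phi> 1"
proof -
  have one: "(0::int) \<le> 1" "1 < int DIM('a)" using dim_ge_2 by auto
  obtain g where g: "symmetry g"
    and im: "\<And>i. -1 \<le> i \<Longrightarrow> i \<le> int DIM('a) \<Longrightarrow> g ` face_at \<Phi> i = face_at (exchange \<Phi> 1) i"
    using flag_transitive[OF \<Phi> flag_exchange[OF \<Phi> one]] by metis
  have im': "g ` face_at \<Phi> i = (if i = 1 then opp \<Phi> 1 else face_at \<Phi> i)" if "-1 \<le> i" "i \<le> int DIM('a)" for i
    using im[OF that] face_at_exchange[OF \<Phi> one that] by simp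
  have gv: "g v = v" using im'[of 0] v by simp
  have "g ` face_at \<Phi> 1 = opp \<Phi> 1" using im'[of 1] one by simp
  then have "g ` {v, p} = {v, q}" by (simp add: p q)
  moreover have "v \<noteq> p" "v \<noteq> q"
    using face_at(2)[OF \<Phi>, of 1] aff_dim_opp[OF \<Phi> one] one by (auto simp: p q)
  ultimately have gp: "g p = q" using gv by (auto simp: doubleton_eq_iff)
  have "g ` opp \<Phi> 1 = opp (exchange \<Phi> 1) 1"
    using one by (intro image_opp[OF g \<Phi> flag_exchange[OF \<Phi> one] one] im) auto
  then have "g ` {v, q} = {v, p}" by (simp add: opp_exchange[OF \<Phi> one] p q)
  then have "g q = p" using gv \<open>v \<noteq> p\<close> by (auto simp: doubleton_eq_iff)
  then show ?thesis using that[of g] g gv gp im' \<open>g ` face_at \<Phi> 1 = opp \<Phi> 1\<close> by auto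
qed

text \<open>The heart of the matter: the symmetry exchanging the two edges at \<open>v\<close> of a polygonal face
  preserves the flag of direction spaces, so it acts by signs off that polygon; since it commutes with
  the symmetries changing a face of higher rank, which mix consecutive directions, the sign is constant,
  and the sign \<open>-1\<close> is excluded because \<open>v\<close> is fixed.\<close>

lemma vertex_figure_reflection:
  assumes \<Phi>: "flag P \<Phi>" and v: "face_at \<Phi> 0 = {v}"
    and p: "face_at \<Phi> 1 = {v, p}" and q: "opp \<Phi> 1 = {v, q}"
  obtains g where "symmetry g" "g v = v" "g p = q" "g q = p"
    "\<And>y. y \<bullet> (p - q) = 0 \<Longrightarrow> g y = y"
proof -
  have one: "(0::int) \<le> 1" "1 < int DIM('a)" using dim_ge_2 by auto
  obtain g where g: "symmetry g" and gv: "g v = v" and gp: "g p = q" and gq: "g q = p"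
    and im: "\<And>i. -1 \<le> i \<Longrightarrow> i \<le> int DIM('a) \<Longrightarrow> i \<noteq> 1 \<Longrightarrow> g ` face_at \<Phi> i = face_at \<Phi> i"
    and im1: "g ` face_at \<Phi> 1 = opp \<Phi> 1"
    using vertex_figure_reflection_data[OF assms] by metis
  interpret g: linear g by (rule symmetry_linear[OF g])
  \<comment> \<open>\<open>Y\<close> is the plane of directions of the polygon containing both
    edges, \<open>D i\<close> the direction space at \<open>v\<close> of the face of rank
    \<open>i\<close>, and \<open>T\<close> the orthogonal complement of \<open>Y\<close>. The action
    of \<open>g\<close> is determined separately on \<open>Y\<close> and on
    \<open>T\<close>.\<close>
  define Y where "Y = span {p - v, q - v}"
  define D where "D i = span ((\<lambda>w. w - v) ` face_at \<Phi> i)" for i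
  define T where "T = {y. \<forall>z\<in>Y. y \<bullet> z = 0}"
  have pq: "p \<noteq> q" using opp(4)[OF \<Phi> one] p q by auto
  have Yp: "p - v \<in> Y" "q - v \<in> Y" by (auto simp: Y_def span_base)
  have pqY: "p - q \<in> Y" using span_diff[OF Yp[unfolded Y_def]] by (simp add: Y_def)
  have subY: "subspace Y" by (simp add: Y_def)
  have subT: "subspace T" by (auto simp: T_def subspace_def inner_add_left)
  have YT: "y = 0" if "y \<in> Y" "y \<in> T" for y using that by (auto simp: T_def)
  have decomp: "\<exists>a b. a \<in> Y \<and> b \<in> T \<and> x = a + b" for x
  proof -
    obtain a b where "a \<in> Y" "\<And>w. w \<in> Y \<Longrightarrow> orthogonal b w" "x = a + b"
      unfolding Y_def using orthogonal_subspace_decomp_exists[of "{p - v, q - v}" x] by metis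
    then show ?thesis by (auto simp: T_def orthogonal_def)
  qed
  have v_in: "v \<in> face_at \<Phi> i" if "0 \<le> i" "i \<le> int DIM('a)" for i
    using face_at_mono[OF \<Phi>, of 0 i] that v by auto
  have D_step: "D (i + 1) \<subseteq> span ((\<lambda>w. w - v) ` face_at \<Phi> i \<union> (\<lambda>w. w - v) ` opp \<Phi> i)"
    if "0 \<le> i" "i < int DIM('a)" for i
    unfolding D_def
    using dir_span_subset[OF _ face_in_affine_hull[OF \<Phi> that], of v] v_in[of i] that
    by (intro span_minimal) (auto simp: image_Un)
  have D_mono: "D i \<subseteq> D j" if "0 \<le> i" "i \<le> j" "j \<le> int DIM('a)" for i j
    unfolding D_def using face_at_mono[OF \<Phi>, of i j] that by (intro span_mono image_mono) auto
  \<comment> \<open>Two edges at \<open>v\<close> already give all directions of the polygon, so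
    that \<open>D 2 = Y\<close>.\<close>
  have D2Y: "D 2 \<subseteq> Y"
  proof -
    have "D 2 \<subseteq> span ((\<lambda>w. w - v) ` face_at \<Phi> 1 \<union> (\<lambda>w. w - v) ` opp \<Phi> 1)"
      using D_step[of 1] one by simp
    also have "\<dots> \<subseteq> Y" unfolding Y_def p q by (intro span_minimal) (auto simp: span_base span_zero)
    finally show ?thesis .
  qed
  have YD2: "Y \<subseteq> D 2"
  proof -
    have "p \<in> face_at \<Phi> 2" using face_at_mono[OF \<Phi>, of 1 2] one p by auto
    moreover have "q \<in> face_at \<Phi> 2" using opp(3)[OF \<Phi> one] q by auto
    ultimately show ?thesis unfolding Y_def D_def by (intro span_mono) auto
  qed
  have D_top: "D (int DIM('a)) = UNIV"
  proof -
    have "affine hull (\<Union>P) = UNIV" using aff_dim_top aff_dim_eq_full by blast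
    then have "(\<lambda>w. w - v) ` UNIV \<subseteq> span ((\<lambda>w. w - v) ` \<Union>P)"
      using v_in[of "int DIM('a)"] face_at_top[OF \<Phi>] by (intro dir_span_subset) auto
    moreover have "range (\<lambda>w. w - v) = UNIV" by (rule surjI[of _ "\<lambda>w. w + v"]) simp
    ultimately show ?thesis unfolding D_def face_at_top[OF \<Phi>] by auto
  qed
  have image_D: "h y \<in> D i" if "symmetry h" "h v = v" "h ` face_at \<Phi> i = face_at \<Phi> i" "y \<in> D i" for h i y
  proof -
    have "h ` D i = span (h ` (\<lambda>w. w - v) ` face_at \<Phi> i)"
      unfolding D_def by (rule linear_span_image[OF symmetry_linear[OF that(1)], symmetric])
    also have "h ` (\<lambda>w. w - v) ` face_at \<Phi> i = (\<lambda>w. w - v) ` h ` face_at \<Phi> i"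
      by (simp add: image_image symmetry_diff[OF that(1)] that(2))
    finally show ?thesis using that by (auto simp: D_def)
  qed
  have gimg: "g ` Y = Y"
  proof -
    have "g ` Y = span (g ` {p - v, q - v})"
      unfolding Y_def by (rule linear_span_image[OF symmetry_linear[OF g], symmetric])
    also have "\<dots> = Y" by (simp add: Y_def symmetry_diff[OF g] gp gq gv insert_commute)
    finally show ?thesis .
  qed
  then have gY: "g y \<in> Y" if "y \<in> Y" for y using imageI[OF that, of g] by simp
  have gT: "g y \<in> T" if "y \<in> T" for y
  proof -
    have "g y \<bullet> z = 0" if "z \<in> Y" for z
    proof -
      from that have "z \<in> g ` Y" by (simp add: gimg)
      then obtain z' where "z' \<in> Y" "z = g z'" by auto
      then show ?thesis using \<open>y \<in> T\<close> by (simp add: T_def symmetry_inner[OF g])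
    qed
    then show ?thesis by (simp add: T_def)
  qed
  \<comment> \<open>On the generators of \<open>Y\<close>, which \<open>g\<close> swaps, the
    difference \<open>y - g y\<close> is plus or minus \<open>p - q\<close>.\<close>
  have Ydiff: "y - g y \<in> span {p - q}" if "y \<in> Y" for y
    using that unfolding Y_def
  proof (induction rule: span_induct_alt)
    case base show ?case by (simp add: g.zero span_zero)
  next
    case (step c x y)
    have "x - g x \<in> span {p - q}"
    proof -
      have "p - q \<in> span {p - q}" "q - p \<in> span {p - q}"
        using span_base[of "p - q" "{p - q}"] span_neg[of "p - q" "{p - q}"] by auto
      then show ?thesis using step(1) by (auto simp: symmetry_diff[OF g] gp gq gv)
    qed
    then have "c *\<^sub>R (x - g x) + (y - g y) \<in> span {p - q}" using step(2) by (intro span_add span_scale)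
    then show ?case by (simp add: g.add g.scale algebra_simps)
  qed
  \<comment> \<open>As \<open>g\<close> negates \<open>p - q\<close>, the difference
    \<open>y - g y\<close> is orthogonal to \<open>p - q\<close> as well as parallel to it.\<close>
  have Yfix: "g y = y" if y: "y \<in> Y" "y \<bullet> (p - q) = 0" for y
  proof -
    obtain c where c: "y - g y = c *\<^sub>R (p - q)" using Ydiff[OF y(1)] by (auto simp: span_singleton)
    have "g y \<bullet> g (p - q) = 0" using that(2) by (simp add: symmetry_inner[OF g])
    then have "g y \<bullet> (p - q) = 0" by (simp add: symmetry_diff[OF g] gp gq inner_diff_right)
    then have "(y - g y) \<bullet> (p - q) = 0" using that(2) by (simp add: inner_diff_left)
    then have "c = 0" using pq by (simp add: c)
    then show ?thesis using c by simp
  qed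
  have sign: "\<exists>\<epsilon>. \<epsilon> \<in> {1, -1} \<and> (\<forall>y\<in>T. g y = \<epsilon> *\<^sub>R y)" if dim3: "3 \<le> DIM('a)"
  proof -
    have three: "3 \<le> int DIM('a)" using dim3 by simp
    have dims: "aff_dim (face_at \<Phi> 2) = 2" "aff_dim (face_at \<Phi> 3) = 3" using face_at(2)[OF \<Phi>] three by auto
    have sub23: "face_at \<Phi> 2 \<subseteq> face_at \<Phi> 3" using face_at_mono[OF \<Phi>, of 2 3] three by auto
    \<comment> \<open>A vertex \<open>w\<close> of the face of rank 3 off the plane of the polygon:
      the component \<open>e\<close> of \<open>w - v\<close> in \<open>T\<close> spans
      \<open>D 3 \<inter> T\<close>, and \<open>g\<close> preserves both this line and norms, hence
      acts there by a sign.\<close>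
    have "\<not> face_at \<Phi> 3 \<subseteq> affine hull (face_at \<Phi> 2)"
      using aff_dim_subset[of "face_at \<Phi> 3" "affine hull (face_at \<Phi> 2)"] dims by auto
    then obtain w where w: "w \<in> face_at \<Phi> 3" "w \<notin> affine hull (face_at \<Phi> 2)" by blast
    then have "aff_dim (insert w (face_at \<Phi> 2)) = aff_dim (face_at \<Phi> 3)" using dims by (simp add: aff_dim_insert)
    then have "affine hull (insert w (face_at \<Phi> 2)) = affine hull (face_at \<Phi> 3)"
      using aff_dim_eq_full_gen[of "insert w (face_at \<Phi> 2)" "face_at \<Phi> 3"] sub23 w(1) by blast
    then have "face_at \<Phi> 3 \<subseteq> affine hull (insert w (face_at \<Phi> 2))" by (simp add: hull_subset)
    then have "(\<lambda>w. w - v) ` face_at \<Phi> 3 \<subseteq> span ((\<lambda>w. w - v) ` insert w (face_at \<Phi> 2))"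
      using v_in[of 2] three by (intro dir_span_subset) auto
    then have D3: "D 3 \<subseteq> span (insert (w - v) ((\<lambda>w. w - v) ` face_at \<Phi> 2))"
      unfolding D_def by (intro span_minimal) auto
    obtain a e where ae: "a \<in> Y" "e \<in> T" "w - v = a + e" using decomp by blast
    have "w - v \<in> D 3" using w(1) by (auto simp: D_def span_base)
    moreover have "a \<in> D 3" using ae YD2 D_mono[of 2 3] three by auto
    ultimately have eD: "e \<in> D 3" using ae(3) span_diff unfolding D_def by (metis add_diff_cancel_left')
    have line: "\<exists>c. y = c *\<^sub>R e" if y: "y \<in> D 3" "y \<in> T" for y
    proof -
      have "y \<in> span (insert (w - v) ((\<lambda>w. w - v) ` face_at \<Phi> 2))" using y(1) D3 by blast
      then obtain c where "y - c *\<^sub>R (w - v) \<in> D 2"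
        by (auto simp: span_breakdown_eq D_def)
      then have "y - c *\<^sub>R (w - v) \<in> Y" using D2Y by blast
      then have "y - c *\<^sub>R (w - v) + c *\<^sub>R a \<in> Y" using ae(1) subY by (intro subspace_add subspace_scale)
      then have "y - c *\<^sub>R e \<in> Y" using ae(3) by (simp add: algebra_simps)
      moreover have "y - c *\<^sub>R e \<in> T" using that(2) ae(2) subT by (intro subspace_diff subspace_scale)
      ultimately show ?thesis using YT by fastforce
    qed
    have "g e \<in> D 3" using image_D[OF g gv im eD] three by simp
    then obtain c where c: "g e = c *\<^sub>R e" using line gT ae(2) by blast
    have "norm (g e) = norm e" by (rule symmetry_norm[OF g])
    then have "\<bar>c\<bar> = 1 \<or> e = 0" by (auto simp: c)
    then obtain \<epsilon> where \<epsilon>: "\<epsilon> \<in> {1, -1}" "g e = \<epsilon> *\<^sub>R e"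
      using c by (cases "e = 0") (auto simp: abs_if g.zero split: if_splits)
    have "\<forall>y\<in>D (int j) \<inter> T. g y = \<epsilon> *\<^sub>R y" if "3 \<le> j" "j \<le> DIM('a)" for j
      using that
    proof (induction j rule: dec_induct)
      case base
      show ?case using line \<epsilon>(2) by (fastforce simp: g.scale)
    next
      case (step j)
      have j: "0 \<le> int j" "int j < int DIM('a)" "3 \<le> int j" using step by auto
      note E = flag_exchange[OF \<Phi> j(1,2)]
      \<comment> \<open>\<open>h\<close> changes only the face of rank \<open>j\<close>. As
        \<open>j \<ge> 3\<close> it fixes \<open>v\<close>, \<open>p\<close> and \<open>q\<close>,
        so it is the identity on \<open>Y\<close> and preserves \<open>T\<close>, while
        \<open>D j\<close> and its image under \<open>h\<close> together span
        \<open>D (j + 1)\<close>.\<close>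
      obtain h where h: "symmetry h"
        and hE: "\<And>i. -1 \<le> i \<Longrightarrow> i \<le> int DIM('a) \<Longrightarrow> h ` face_at \<Phi> i = face_at (exchange \<Phi> (int j)) i"
        using flag_transitive[OF \<Phi> E] by metis
      have him: "h ` face_at \<Phi> i = (if i = int j then opp \<Phi> (int j) else face_at \<Phi> i)"
        if "-1 \<le> i" "i \<le> int DIM('a)" for i
        using hE[OF that] face_at_exchange[OF \<Phi> j(1,2) that] by simp
      interpret h: linear h by (rule symmetry_linear[OF h])
      have hv: "h v = v" using him[of 0] v j by simp
      have hp: "h p = p" 
      proof -
        have "h ` {v, p} = {v, p}" using him[of 1] p j one by simp
        then show ?thesis using hv by (auto simp: doubleton_eq_iff)
      qed
      have hopp: "h ` opp \<Phi> 1 = opp \<Phi> 1"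
      proof (rule image_opp[OF h \<Phi> \<Phi> one])
        fix k :: int assume "k \<in> {1 - 1, 1, 1 + 1}"
        then have "-1 \<le> k" "k \<le> int DIM('a)" "k \<noteq> int j" using one j by auto
        then show "h ` face_at \<Phi> k = face_at \<Phi> k" using him[of k] by simp
      qed
      have hq: "h q = q"
        using hopp hv unfolding q by (auto simp: doubleton_eq_iff)
      have hY: "h y = y" if "y \<in> Y" for y
      proof -
        have "h x = id x" if "x \<in> {p - v, q - v}" for x
          using that by (auto simp: symmetry_diff[OF h] hv hp hq)
        then have "h y = id y"
          using linear_eq_on_span[OF symmetry_linear[OF h] linear_id _ that[unfolded Y_def]] by blast
        then show ?thesis by simp
      qed
      have hT: "h y \<in> T" if "y \<in> T" for y
      proof -
        have "h y \<bullet> z = 0" if "z \<in> Y" for z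
          using \<open>y \<in> T\<close> that symmetry_inner[OF h, of y z] hY[OF that] by (simp add: T_def)
        then show ?thesis by (simp add: T_def)
      qed
      have gopp: "g ` opp \<Phi> (int j) = opp \<Phi> (int j)"
        using j by (intro image_opp[OF g \<Phi> \<Phi> j(1,2)] im) auto
      \<comment> \<open>Ranks 1 and \<open>j\<close> are at least two apart, so neither exchange
        disturbs the three faces that determine the other. Both products act alike on
        \<open>\<Phi>\<close>, and rigidity applies.\<close>
      have comm: "g \<circ> h = h \<circ> g"
      proof (rule symmetry_eqI[OF symmetry_compose[OF g h] symmetry_compose[OF h g] \<Phi>])
        fix i assume i: "-1 \<le> i" "i \<le> int DIM('a)"
        consider "i = int j" | "i = 1" | "i \<noteq> int j" "i \<noteq> 1" by blast
        then have "g ` h ` face_at \<Phi> i = h ` g ` face_at \<Phi> i"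
        proof cases
          case 1 then show ?thesis using him[OF i] im[OF i] gopp j by simp
        next
          case 2 then show ?thesis using him[OF i] im1 hopp j by simp
        next
          case 3 then show ?thesis using him[OF i] im[OF i] by simp
        qed
        then show "(g \<circ> h) ` face_at \<Phi> i = (h \<circ> g) ` face_at \<Phi> i" by (simp only: image_comp)
      qed
      have oppD: "span ((\<lambda>w. w - v) ` opp \<Phi> (int j)) = h ` D (int j)"
      proof -
        have "opp \<Phi> (int j) = h ` face_at \<Phi> (int j)" using him[of "int j"] j by simp
        then have "(\<lambda>w. w - v) ` opp \<Phi> (int j) = h ` (\<lambda>w. w - v) ` face_at \<Phi> (int j)"
          by (simp add: image_image symmetry_diff[OF h] hv)
        then show ?thesis by (simp only: D_def linear_span_image[OF symmetry_linear[OF h]])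
      qed
      have inT: "\<exists>a1 a2. a = a1 + a2 \<and> a1 \<in> Y \<and> a2 \<in> T \<and> a2 \<in> D (int j)" if "a \<in> D (int j)" for a
      proof -
        obtain a1 a2 where a: "a1 \<in> Y" "a2 \<in> T" "a = a1 + a2" using decomp by blast
        moreover have "a1 \<in> D (int j)" using a YD2 D_mono[of 2 "int j"] j by auto
        ultimately have "a2 \<in> D (int j)" using that span_diff[of a _ a1] unfolding D_def by (metis add_diff_cancel_left')
        then show ?thesis using a by blast
      qed
      show ?case
      proof
        fix y assume y: "y \<in> D (int (Suc j)) \<inter> T"
        then have "y \<in> span ((\<lambda>w. w - v) ` face_at \<Phi> (int j) \<union> (\<lambda>w. w - v) ` opp \<Phi> (int j))"
          using D_step[OF j(1,2)] by (auto simp: add.commute)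
        then obtain a b where ab: "a \<in> D (int j)" "b \<in> D (int j)" "y = a + h b"
          unfolding span_Un oppD by (auto simp: D_def)
        obtain a1 a2 where a: "a = a1 + a2" "a1 \<in> Y" "a2 \<in> T" "a2 \<in> D (int j)" using inT[OF ab(1)] by blast
        obtain b1 b2 where b: "b = b1 + b2" "b1 \<in> Y" "b2 \<in> T" "b2 \<in> D (int j)" using inT[OF ab(2)] by blast
        \<comment> \<open>Since \<open>h\<close> is the identity on \<open>Y\<close>, the parts in
          \<open>Y\<close> collect to \<open>a1 + b1\<close>, which vanishes because
          \<open>y\<close> lies in \<open>T\<close>. On the remaining sum the sign is known by
          induction and commutation.\<close>
        have "y - (a2 + h b2) = a1 + b1" using ab(3) a(1) b(1) hY[OF b(2)] by (simp add: h.add algebra_simps)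
        then have "y - (a2 + h b2) \<in> Y" using a b subY by (simp add: subspace_add)
        moreover have "y - (a2 + h b2) \<in> T" using y a b hT subT by (intro subspace_diff subspace_add) auto
        ultimately have "y - (a2 + h b2) = 0" by (rule YT)
        then have yy: "y = a2 + h b2" by simp
        have "g (h b2) = h (g b2)" using comm by (metis comp_apply)
        moreover have "g a2 = \<epsilon> *\<^sub>R a2" "g b2 = \<epsilon> *\<^sub>R b2" using step a b j by auto
        ultimately show "g y = \<epsilon> *\<^sub>R y" by (simp add: yy g.add h.scale scaleR_add_right)
      qed
    qed
    from this[of "DIM('a)"] dim3 D_top \<epsilon>(1) show ?thesis by auto
  qed
  have not_neg: False if dim3: "3 \<le> DIM('a)" and neg: "\<forall>y\<in>T. g y = - y"
  proof -
    have two: "(0::int) \<le> 2" "2 < int DIM('a)" using dim3 by auto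
    \<comment> \<open>The component of the fixed vector \<open>v\<close> in \<open>T\<close> would
      be negated, so it vanishes and \<open>v\<close> lies in the plane \<open>Y\<close>.\<close>
    obtain v1 v2 where v12: "v1 \<in> Y" "v2 \<in> T" "v = v1 + v2" using decomp by blast
    have "v = g v1 - v2" using gv v12 neg by (simp add: g.add)
    then have "2 *\<^sub>R v2 = g v1 - v1" using v12(3) by (simp add: scaleR_2 algebra_simps)
    then have "2 *\<^sub>R v2 \<in> Y" using gY v12 subY by (simp add: subspace_diff)
    then have "2 *\<^sub>R v2 = 0" using YT v12 subT by (metis subspace_scale)
    then have vY: "v \<in> Y" using v12 by simp
    obtain c where c: "v - c *\<^sub>R (p - v) \<in> span {q - v}" using vY by (auto simp: Y_def span_breakdown_eq)
    then obtain d where d: "v - c *\<^sub>R (p - v) = d *\<^sub>R (q - v)" by (auto simp: span_singleton)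
    have v1: "v = c *\<^sub>R (p - v) + d *\<^sub>R (q - v)" using d by (simp add: algebra_simps)
    then have "g v = g (c *\<^sub>R (p - v) + d *\<^sub>R (q - v))" by simp
    then have v2: "v = c *\<^sub>R (q - v) + d *\<^sub>R (p - v)" by (simp add: g.add g.scale g.diff gp gq gv)
    \<comment> \<open>Applying \<open>g\<close> swaps the two coefficients of \<open>v\<close>, so
      they are equal; as \<open>v\<close> is not zero, this relation lets \<open>v\<close> and
      \<open>p\<close> determine \<open>q\<close>.\<close>
    have "(c - d) *\<^sub>R (p - q) = (c *\<^sub>R (p - v) + d *\<^sub>R (q - v)) - (c *\<^sub>R (q - v) + d *\<^sub>R (p - v))"
      by (simp add: algebra_simps)
    also have "\<dots> = 0" using v1 v2 by simp
    finally have "c = d" using pq by simp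
    have "v \<in> \<Union>P" using rank_0_face[OF \<Phi>] v by auto
    then have "v \<noteq> 0" by (rule vertex_nonzero)
    then have "c \<noteq> 0" using v1 \<open>c = d\<close> by (metis add_0 scale_zero_left)
    \<comment> \<open>A symmetry exchanging the face of rank 2 fixes \<open>v\<close> and
      \<open>p\<close>, hence \<open>q\<close> by that relation. It then keeps the polygon inside
      its own affine hull, although it carries it to the opposite face, which leaves that
      hull.\<close>
    obtain h where h: "symmetry h"
      and hE: "\<And>i. -1 \<le> i \<Longrightarrow> i \<le> int DIM('a) \<Longrightarrow> h ` face_at \<Phi> i = face_at (exchange \<Phi> 2) i"
      using flag_transitive[OF \<Phi> flag_exchange[OF \<Phi> two]] by metis
    have him: "h ` face_at \<Phi> i = (if i = 2 then opp \<Phi> 2 else face_at \<Phi> i)" if "-1 \<le> i" "i \<le> int DIM('a)" for i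
      using hE[OF that] face_at_exchange[OF \<Phi> two that] by simp
    interpret h: linear h by (rule symmetry_linear[OF h])
    have hv: "h v = v" using him[of 0] v by simp
    have "h ` {v, p} = {v, p}" using him[of 1] p one by simp
    then have hp: "h p = p" using hv by (auto simp: doubleton_eq_iff)
    have "h v = h (c *\<^sub>R (p - v) + c *\<^sub>R (q - v))" using v1 \<open>c = d\<close> by simp
    then have "v = c *\<^sub>R (p - v) + c *\<^sub>R (h q - v)" by (simp add: h.add h.scale h.diff hp hv)
    then have "c *\<^sub>R (h q - v) = c *\<^sub>R (q - v)" using v1 \<open>c = d\<close> by (metis add_left_cancel)
    then have hq: "h q = q" using \<open>c \<noteq> 0\<close> by simp
    have "h ` face_at \<Phi> 2 \<subseteq> h ` (affine hull (face_at \<Phi> 1 \<union> opp \<Phi> 1))"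
      using face_in_affine_hull[OF \<Phi> one] by auto
    also have "\<dots> = affine hull (h ` (face_at \<Phi> 1 \<union> opp \<Phi> 1))"
      using affine_hull_linear_image symmetry_linear[OF h] linear_conv_bounded_linear by blast
    also have "h ` (face_at \<Phi> 1 \<union> opp \<Phi> 1) = face_at \<Phi> 1 \<union> opp \<Phi> 1"
      by (simp add: p q hp hq hv)
    also have "affine hull \<dots> \<subseteq> affine hull (face_at \<Phi> 2)"
      using opp(3)[OF \<Phi> one] face_at_mono[OF \<Phi>, of 1 2] two by (intro hull_mono) auto
    finally show False using him[of 2] two opp_not_in_affine_hull[OF \<Phi> two] by simp
  qed
  have Tfix: "g y = y" if "y \<in> T" for y
  proof (cases "3 \<le> DIM('a)")
    case True
    then obtain \<epsilon> where "\<epsilon> \<in> {1, -1}" "\<forall>y\<in>T. g y = \<epsilon> *\<^sub>R y" using sign by blast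
    then show ?thesis using not_neg[OF True] that by auto
  next
    case False
    \<comment> \<open>In dimension two \<open>Y\<close> is the whole space and \<open>T\<close> is
      trivial.\<close>
    then have "int DIM('a) = 2" using dim_ge_2 by simp
    then have "D 2 = UNIV" using D_top by (simp only:)
    then have "y = 0" using YT[OF _ that] D2Y by blast
    then show ?thesis by (simp add: g.zero)
  qed
  have "g y = y" if y: "y \<bullet> (p - q) = 0" for y
  proof -
    obtain a b where ab: "a \<in> Y" "b \<in> T" "y = a + b" using decomp by blast
    have "b \<bullet> (p - q) = 0" using ab(2) pqY by (simp add: T_def)
    then have "a \<bullet> (p - q) = 0" using y ab(3) by (simp add: inner_add_left)
    then show ?thesis using Yfix[OF ab(1)] Tfix[OF ab(2)] ab(3) by (simp add: g.add)
  qed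
  then show ?thesis using that[OF g gv gp gq] by blast
qed

end

section \<open>Second moments of vertices and edges\<close>

text \<open>The bilinear form of the matrix \<open>\<Sum>w w\<^sup>T\<close>, with \<open>w\<close>
  running over \<open>S\<close>.\<close>

definition moment :: "'a::euclidean_space set \<Rightarrow> 'a \<Rightarrow> 'a \<Rightarrow> real" where
  "moment S x y = (\<Sum>w\<in>S. (w \<bullet> x) * (w \<bullet> y))"

lemma moment_commute: "moment S x y = moment S y x"
  by (simp add: moment_def mult.commute)

lemma moment_add: "moment S (x + x') y = moment S x y + moment S x' y"
  by (simp add: moment_def inner_add_right distrib_right sum.distrib)

lemma moment_scale: "moment S (c *\<^sub>R x) y = c * moment S x y"
  by (simp add: moment_def sum_distrib_left mult.assoc)

lemma moment_zero: "moment S 0 y = 0"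
  by (simp add: moment_def)

lemma moment_minus: "moment S (- x) y = - moment S x y"
  using moment_scale[of S "-1"] by simp

lemma moment_image:
  assumes "orthogonal_transformation g"
  shows "moment (g ` S) (g x) (g y) = moment S x y"
proof -
  have "inj_on g S" using orthogonal_transformation_inj[OF assms] by (metis inj_on_subset subset_UNIV)
  then show ?thesis
    by (simp add: moment_def sum.reindex orthogonal_transformation_inner[OF assms])
qed

lemma decompose_along:
  fixes v x :: "'a::euclidean_space"
  assumes "v \<noteq> 0"
  obtains c x' where "x = c *\<^sub>R v + x'" "x' \<bullet> v = 0"
  using assms that[of "(x \<bullet> v) / (v \<bullet> v)" "x - ((x \<bullet> v) / (v \<bullet> v)) *\<^sub>R v"]
  by (simp add: inner_diff_left)

context regular_polytope
begin

section \<open>Roots of the reflections fixing a vertex\<close>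

lemma symmetry_orthogonal: "symmetry g \<Longrightarrow> orthogonal_transformation g"
  by (simp add: symmetry_def)

text \<open>Normals of the mirrors containing \<open>v\<close>; \<open>p\<close> and
  \<open>q\<close> are the far ends of the two edges at \<open>v\<close> of one polygonal face.
  Indexing by flags makes the roots a single orbit under the stabiliser of \<open>v\<close>.\<close>

definition roots :: "'a \<Rightarrow> 'a set" where
  "roots v = {p - q | p q. \<exists>\<Phi>. flag P \<Phi> \<and> face_at \<Phi> 0 = {v} \<and> face_at \<Phi> 1 = {v, p} \<and> opp \<Phi> 1 = {v, q}}"

lemma dim_gt_1: "(0::int) \<le> 1" "1 < int DIM('a)"
  using dim_ge_2 by auto

lemma opp_edge:
  assumes "flag P \<Phi>" "face_at \<Phi> 0 = {v}"
  obtains q where "opp \<Phi> 1 = {v, q}" "q \<in> nbrs v"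
proof -
  have "face_at (exchange \<Phi> 1) 0 = {v}" "face_at (exchange \<Phi> 1) 1 = opp \<Phi> 1"
    using face_at_exchange[OF assms(1) dim_gt_1] dim_gt_1 assms(2) by auto
  then show ?thesis using flag_edge[OF flag_exchange[OF assms(1) dim_gt_1]] that by metis
qed

lemma root_reflection:
  assumes "r \<in> roots v"
  obtains g where "symmetry g" "g v = v" "g r = - r" "\<And>y. y \<bullet> r = 0 \<Longrightarrow> g y = y"
proof -
  obtain p q \<Phi> where r: "r = p - q" and \<Phi>: "flag P \<Phi>" "face_at \<Phi> 0 = {v}" "face_at \<Phi> 1 = {v, p}" "opp \<Phi> 1 = {v, q}"
    using assms by (auto simp: roots_def)
  obtain g where "symmetry g" "g v = v" "g p = q" "g q = p" "\<And>y. y \<bullet> (p - q) = 0 \<Longrightarrow> g y = y"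
    using vertex_figure_reflection[OF \<Phi>] by metis
  then show ?thesis using that[of g] by (simp add: r symmetry_diff)
qed

text \<open>The reflection fixes \<open>v\<close> and negates \<open>r\<close> while preserving
  their inner product.\<close>

lemma roots_orthogonal:
  assumes "r \<in> roots v" shows "r \<bullet> v = 0"
proof -
  obtain g where g: "symmetry g" "g v = v" "g r = - r" using root_reflection[OF assms] by metis
  show ?thesis using symmetry_inner[OF g(1), of r v] g by simp
qed

lemma roots_transitive:
  assumes "r \<in> roots v" "s \<in> roots v"
  obtains g where "symmetry g" "g v = v" "g r = s"
proof -
  obtain p q \<Phi> where r: "r = p - q" and \<Phi>: "flag P \<Phi>" "face_at \<Phi> 0 = {v}" "face_at \<Phi> 1 = {v, p}" "opp \<Phi> 1 = {v, q}"
    using assms(1) by (auto simp: roots_def)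
  obtain p' q' \<Psi> where s: "s = p' - q'" and \<Psi>: "flag P \<Psi>" "face_at \<Psi> 0 = {v}" "face_at \<Psi> 1 = {v, p'}" "opp \<Psi> 1 = {v, q'}"
    using assms(2) by (auto simp: roots_def)
  obtain g where g: "symmetry g"
    and im: "\<And>i. -1 \<le> i \<Longrightarrow> i \<le> int DIM('a) \<Longrightarrow> g ` face_at \<Phi> i = face_at \<Psi> i"
    using flag_transitive[OF \<Phi>(1) \<Psi>(1)] by metis
  have gv: "g v = v" using im[of 0] \<Phi>(2) \<Psi>(2) by simp
  have "g ` {v, p} = {v, p'}" using im[of 1] dim_gt_1 \<Phi>(3) \<Psi>(3) by simp
  then have gp: "g p = p'" using gv by (auto simp: doubleton_eq_iff)
  have "g ` opp \<Phi> 1 = opp \<Psi> 1"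
    using dim_gt_1 by (intro image_opp[OF g \<Phi>(1) \<Psi>(1)] im) auto
  then have "g ` {v, q} = {v, q'}" using \<Phi>(4) \<Psi>(4) by simp
  then have "g q = q'" using gv by (auto simp: doubleton_eq_iff)
  then show ?thesis using that[OF g gv] by (simp add: symmetry_diff[OF g] gp r s)
qed

text \<open>Two edges at \<open>v\<close> are linked by exchanges that never drop \<open>v\<close>.
  Only an exchange at rank 1 changes the edge, and it moves the far end by a root.\<close>

lemma inner_nbrs_const:
  assumes x: "\<And>r. r \<in> roots v \<Longrightarrow> x \<bullet> r = 0" and u: "u \<in> nbrs v" "u' \<in> nbrs v"
  shows "x \<bullet> u = x \<bullet> u'"
proof -
  obtain \<Phi> where \<Phi>: "flag P \<Phi>" "face_at \<Phi> 0 = {v}" "face_at \<Phi> 1 = {v, u}" using flag_through_edge[OF u(1)] by metis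
  obtain \<Psi> where \<Psi>: "flag P \<Psi>" "face_at \<Psi> 0 = {v}" "face_at \<Psi> 1 = {v, u'}" using flag_through_edge[OF u(2)] by metis
  have v: "{v} \<in> \<Phi> \<inter> \<Psi>" using face_at(1)[OF \<Phi>(1), of 0] face_at(1)[OF \<Psi>(1), of 0] \<Phi>(2) \<Psi>(2) by simp
  have "\<forall>w\<in>face_at \<Psi> 1 - {v}. x \<bullet> w = x \<bullet> u" using \<Phi>(1) \<Psi>(1)
  proof (induction rule: flag_induct)
    case start show ?case using \<Phi>(3) by simp
  next
    case (step A i)
    have A0: "face_at A 0 = {v}" using face_at_eq[OF step(1), of "{v}" 0] step(4) v by auto
    show ?case
    proof (cases "i = 1")
      case True
      obtain p where p: "face_at A 1 = {v, p}" "p \<in> nbrs v" using flag_edge[OF step(1) A0] by metis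
      obtain q where q: "opp A 1 = {v, q}" "q \<in> nbrs v" using opp_edge[OF step(1) A0] by metis
      have "p - q \<in> roots v" using step(1) A0 p(1) q(1) by (auto simp: roots_def)
      then have "x \<bullet> q = x \<bullet> p" using x by (fastforce simp: inner_diff_right)
      moreover have "p \<noteq> v" using p(2) by (simp add: nbrs_iff_face)
      ultimately show ?thesis using step(6) True face_at_exchange[OF step(1) dim_gt_1, of 1] dim_gt_1 p q by auto
    next
      case False
      then show ?thesis using step(6) face_at_exchange[OF step(1-3), of 1] dim_gt_1 by simp
    qed
  qed
  moreover have "u' \<noteq> v" using u(2) by (simp add: nbrs_iff_face)
  ultimately show ?thesis using \<Psi>(3) by simp
qed

text \<open>All vertices lie on one sphere about the origin. The strict sign is needed twice: as a
  nonzero denominator, and to control the direction of the sum of the edges.\<close>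

lemma inner_nbr_less:
  assumes "u \<in> nbrs v" shows "v \<bullet> u < v \<bullet> v"
proof -
  have "u \<noteq> v" "{v, u} \<in> P" using assms by (auto simp: nbrs_iff_face)
  then have "norm u = norm v" by (intro norm_vertices) auto
  then have "u \<bullet> u = v \<bullet> v" by (simp add: dot_square_norm)
  moreover have "0 < (u - v) \<bullet> (u - v)" using \<open>u \<noteq> v\<close> by simp
  ultimately show ?thesis by (simp add: inner_diff_left inner_diff_right inner_commute)
qed

lemma nbrs_nonempty:
  assumes "v \<in> \<Union>P" shows "nbrs v \<noteq> {}"
  using edges_at_vertex_span[OF assms, of v] vertex_nonzero[OF assms] by blast

text \<open>Both \<open>x\<close> and \<open>v\<close> have a constant inner product with the
  neighbours of \<open>v\<close>. With \<open>t\<close> chosen so that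
  \<open>x - t *\<^sub>R v\<close> is orthogonal to one edge at \<open>v\<close>, it is orthogonal
  to all of them, hence zero.\<close>

lemma orthogonal_to_roots:
  assumes v: "v \<in> \<Union>P" and x: "\<And>r. r \<in> roots v \<Longrightarrow> x \<bullet> r = 0"
  obtains t where "x = t *\<^sub>R v"
proof -
  obtain u0 where u0: "u0 \<in> nbrs v" using nbrs_nonempty[OF v] by blast
  define t where "t = (x \<bullet> u0 - x \<bullet> v) / (v \<bullet> u0 - v \<bullet> v)"
  have t: "t * (v \<bullet> u0 - v \<bullet> v) = x \<bullet> u0 - x \<bullet> v" using inner_nbr_less[OF u0] by (simp add: t_def)
  have "x - t *\<^sub>R v = 0"
  proof (rule edges_at_vertex_span[OF v])
    fix u assume u: "u \<in> nbrs v"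
    have "x \<bullet> u = x \<bullet> u0" by (rule inner_nbrs_const[OF x u u0])
    moreover have "v \<bullet> u = v \<bullet> u0"
      by (rule inner_nbrs_const[OF _ u u0]) (simp add: roots_orthogonal inner_commute)
    ultimately show "(x - t *\<^sub>R v) \<bullet> (u - v) = 0"
      using t by (simp add: inner_diff_left inner_diff_right right_diff_distrib)
  qed
  then show ?thesis using that[of t] by simp
qed

lemma span_roots:
  assumes v: "v \<in> \<Union>P" and y: "y \<bullet> v = 0"
  shows "y \<in> span (roots v)"
proof -
  obtain a b where ab: "a \<in> span (roots v)" "\<And>w. w \<in> span (roots v) \<Longrightarrow> orthogonal b w" "y = a + b"
    using orthogonal_subspace_decomp_exists[of "roots v" y] by metis
  obtain t where t: "b = t *\<^sub>R v"
    using orthogonal_to_roots[OF v, of b] ab(2) by (metis orthogonal_def span_base)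
  have "orthogonal v a"
    by (rule orthogonal_to_span[OF ab(1)]) (use roots_orthogonal in \<open>simp add: orthogonal_def inner_commute\<close>)
  then have "a \<bullet> v = 0" by (simp add: orthogonal_def inner_commute)
  then have "b \<bullet> v = 0" using y ab(3) by (simp add: inner_add_left)
  then have "b = 0" using t by auto
  then show ?thesis using ab by simp
qed

text \<open>A Schur argument by hand: invariance under its reflection makes each root an eigenvector
  of the form, transitivity on roots makes the eigenvalues equal, and the roots span the complement
  of \<open>v\<close>. Only the value along \<open>v\<close> stays free.\<close>

lemma stabilizer_invariant_moment:
  assumes v: "v \<in> \<Union>P" and S: "\<And>g. symmetry g \<Longrightarrow> g v = v \<Longrightarrow> g ` S = S"
  obtains c k where "\<And>x y. moment S x y = c * (x \<bullet> y) + k * ((v \<bullet> x) * (v \<bullet> y))"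
proof -
  have inv: "moment S (g x) (g y) = moment S x y" if "symmetry g" "g v = v" for g x y
    using moment_image[OF symmetry_orthogonal[OF that(1)], of S x y] S[OF that] by simp
  have r0: "moment S r y = 0" if r: "r \<in> roots v" and y: "y \<bullet> r = 0" for r y
  proof -
    obtain g where g: "symmetry g" "g v = v" "g r = - r" "\<And>y. y \<bullet> r = 0 \<Longrightarrow> g y = y"
      using root_reflection[OF r] by metis
    then have "moment S r y = moment S (- r) y" using inv[OF g(1,2), of r y] g(4)[OF y] by simp
    then show ?thesis by (simp add: moment_minus)
  qed
  obtain c where c: "\<And>r. r \<in> roots v \<Longrightarrow> moment S r r = c * (r \<bullet> r)"
  proof (cases "roots v \<subseteq> {0}")
    \<comment> \<open>Without a nonzero root any eigenvalue would do; 0 is taken.\<close>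
    case True
    then have "\<And>r. r \<in> roots v \<Longrightarrow> moment S r r = 0 * (r \<bullet> r)" by (auto simp: moment_zero)
    then show ?thesis using that by blast
  next
    case False
    then obtain s where s: "s \<in> roots v" "s \<noteq> 0" by blast
    show ?thesis
    proof (rule that)
      fix r assume r: "r \<in> roots v"
      obtain g where g: "symmetry g" "g v = v" "g s = r" using roots_transitive[OF s(1) r] by metis
      have "moment S r r = moment S s s" "r \<bullet> r = s \<bullet> s"
        using inv[OF g(1,2), of s s] symmetry_inner[OF g(1), of s s] g(3) by auto
      then show "moment S r r = moment S s s / (s \<bullet> s) * (r \<bullet> r)" using s by simp
    qed
  qed
  have roots: "moment S r y = c * (r \<bullet> y)" if r: "r \<in> roots v" for r y
  proof (cases "r = 0")
    case True then show ?thesis by (simp add: moment_zero)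
  next
    case False
    obtain a y' where y: "y = a *\<^sub>R r + y'" "y' \<bullet> r = 0" using decompose_along[OF False] by metis
    have "moment S r y = moment S y r" by (rule moment_commute)
    also have "\<dots> = a * moment S r r + moment S y' r" by (simp add: y(1) moment_add moment_scale)
    also have "moment S y' r = 0" using r0[OF r y(2)] moment_commute[of S y' r] by simp
    also have "a * moment S r r + 0 = c * (r \<bullet> y)"
      using c[OF r] y(2) by (simp add: y(1) inner_add_right inner_commute[of r y'])
    finally show ?thesis .
  qed
  have perp: "moment S x y = c * (x \<bullet> y)" if "x \<bullet> v = 0" for x y
    using span_roots[OF v that]
  proof (induction rule: span_induct_alt)
    case base show ?case by (simp add: moment_zero)
  next
    case (step a r x)
    then show ?case using roots[OF step(1)]
      by (simp add: moment_add moment_scale inner_add_left distrib_left)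
  qed
  \<comment> \<open>Solved from the claim at \<open>x = y = v\<close>.\<close>
  define k where "k = (moment S v v - c * (v \<bullet> v)) / (v \<bullet> v) ^ 2"
  have vv: "v \<bullet> v \<noteq> 0" using vertex_nonzero[OF v] by simp
  then have k: "moment S v v = c * (v \<bullet> v) + k * (v \<bullet> v) ^ 2" by (simp add: k_def)
  have "moment S x y = c * (x \<bullet> y) + k * ((v \<bullet> x) * (v \<bullet> y))" for x y
  proof -
    obtain a x' where x: "x = a *\<^sub>R v + x'" "x' \<bullet> v = 0" using decompose_along[OF vertex_nonzero[OF v]] by metis
    obtain b y' where y: "y = b *\<^sub>R v + y'" "y' \<bullet> v = 0" using decompose_along[OF vertex_nonzero[OF v]] by metis
    have "moment S x y = a * moment S v y + c * (x' \<bullet> y)" by (simp add: x(1) moment_add moment_scale perp[OF x(2)])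
    also have "moment S v y = b * moment S v v + c * (y' \<bullet> v)"
      unfolding moment_commute[of S v y] by (simp add: y(1) moment_add moment_scale perp[OF y(2)])
    finally show ?thesis
      using x(2) y(2) k
      by (simp add: x(1) y(1) inner_add_left inner_add_right inner_commute[of v x'] inner_commute[of v y']
          distrib_left distrib_right power2_eq_square)
  qed
  then show ?thesis using that by blast
qed

text \<open>Here the set is invariant under all symmetries. One vertex is an eigenvector by the
  previous lemma, with eigenvalue \<open>d\<close> in the proof; by transitivity every vertex is one
  with the same eigenvalue, and the vertices span.\<close>

lemma vertex_moment:
  obtains c where "\<And>x y. moment (\<Union>P) x y = c * (x \<bullet> y)"
proof -
  obtain v0 where v0: "v0 \<in> \<Union>P" using vertices_nonempty by blast
  obtain c k where ck: "\<And>x y. moment (\<Union>P) x y = c * (x \<bullet> y) + k * ((v0 \<bullet> x) * (v0 \<bullet> y))"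
    using stabilizer_invariant_moment[OF v0 symmetry_vertices] by metis
  define d where "d = c + k * (v0 \<bullet> v0)"
  have vert: "moment (\<Union>P) w y = d * (w \<bullet> y)" if w: "w \<in> \<Union>P" for w y
  proof -
    obtain g where g: "symmetry g" "g v0 = w" using vertex_transitive[OF v0 w] by metis
    obtain y' where y': "y = g y'" using symmetry_surj[OF g(1)] by (metis surjD)
    have "moment (\<Union>P) w y = moment (\<Union>P) v0 y'"
      using moment_image[OF symmetry_orthogonal[OF g(1)], of "\<Union>P" v0 y'] symmetry_vertices[OF g(1)] g(2) y' by simp
    also have "\<dots> = d * (v0 \<bullet> y')" by (simp add: ck d_def algebra_simps)
    also have "v0 \<bullet> y' = w \<bullet> y" using symmetry_inner[OF g(1), of v0 y'] g(2) y' by simp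
    finally show ?thesis .
  qed
  have "moment (\<Union>P) x y = d * (x \<bullet> y)" if "x \<in> span (\<Union>P)" for x y
    using that
  proof (induction rule: span_induct_alt)
    case base show ?case by (simp add: moment_zero)
  next
    case (step a r x)
    then show ?case using vert[of r y] by (simp add: moment_add moment_scale inner_add_left distrib_left)
  qed
  then show ?thesis using that span_vertices by (metis UNIV_I)
qed

definition edges :: "'a \<Rightarrow> 'a set" where
  "edges v = (\<lambda>u. u - v) ` nbrs v"

lemma edges_image: "symmetry g \<Longrightarrow> g ` edges v = edges (g v)"
  by (simp add: edges_def image_image symmetry_diff nbrs_image[symmetric])

text \<open>Transporting the form by vertex transitivity keeps \<open>c\<close>, which must be
  common to all vertices because it fixes the height. The coefficient \<open>k\<close> may be
  quantified after the vertex, as \<gamma> absorbs it there.\<close>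

lemma edge_moment:
  obtains c where "c > 0" "\<And>v. v \<in> \<Union>P \<Longrightarrow> \<exists>k. \<forall>x y. moment (edges v) x y = c * (x \<bullet> y) + k * ((v \<bullet> x) * (v \<bullet> y))"
proof -
  obtain v where v: "v \<in> \<Union>P" using vertices_nonempty by blast
  obtain c k where ck: "\<And>x y. moment (edges v) x y = c * (x \<bullet> y) + k * ((v \<bullet> x) * (v \<bullet> y))"
    using stabilizer_invariant_moment[OF v, of "edges v"] edges_image by metis
  have "\<exists>k. \<forall>x y. moment (edges w) x y = c * (x \<bullet> y) + k * ((w \<bullet> x) * (w \<bullet> y))" if w: "w \<in> \<Union>P" for w
  proof -
    obtain g where g: "symmetry g" "g v = w" using vertex_transitive[OF v w] by metis
    have "moment (edges w) x y = c * (x \<bullet> y) + k * ((w \<bullet> x) * (w \<bullet> y))" for x y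
    proof -
      obtain x' y' where "x = g x'" "y = g y'" using symmetry_surj[OF g(1)] by (metis surjD)
      moreover have "moment (edges w) (g x') (g y') = moment (edges v) x' y'"
        using moment_image[OF symmetry_orthogonal[OF g(1)], of "edges v" x' y'] edges_image[OF g(1), of v] g(2) by simp
      ultimately show ?thesis
        using ck symmetry_inner[OF g(1)] g(2) by metis
    qed
    then show ?thesis by blast
  qed
  moreover have "c > 0"
  proof -
    \<comment> \<open>A direction orthogonal to \<open>v\<close> isolates \<open>c\<close>; it is
      not orthogonal to all edges at \<open>v\<close>, so the sum of squares is positive.\<close>
    obtain e where e: "e \<noteq> 0" "orthogonal v e" using orthogonal_to_vector_exists[of v] dim_ge_2 by auto
    have ve: "v \<bullet> e = 0" using e(2) by (simp add: orthogonal_def)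
    obtain u where u: "u \<in> nbrs v" "e \<bullet> (u - v) \<noteq> 0" using edges_at_vertex_span[OF v] e(1) by blast
    have "0 < moment (edges v) e e"
      unfolding moment_def
      using u finite_nbrs[of v]
      by (intro sum_pos2[of _ "u - v"]) (auto simp: edges_def inner_commute zero_less_mult_iff not_less le_less)
    then have "0 < c * (e \<bullet> e)" by (simp add: ck ve)
    then show ?thesis using e(1) zero_less_mult_pos2[of c "e \<bullet> e"] by simp
  qed
  ultimately show ?thesis using that by blast
qed

text \<open>The reflections fixing \<open>v\<close> permute the edges, so the sum is orthogonal to
  every root. Its sign guarantees that the edges to the apexes, which add another
  \<open>- 2 *\<^sub>R v\<close>, cannot cancel it.\<close>

lemma sum_edges:
  assumes v: "v \<in> \<Union>P"
  obtains k where "k \<ge> 0" "(\<Sum>w\<in>edges v. w) = - (k *\<^sub>R v)"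
proof -
  let ?s = "\<Sum>w\<in>edges v. w"
  have "?s \<bullet> r = 0" if r: "r \<in> roots v" for r
  proof -
    obtain g where g: "symmetry g" "g v = v" "g r = - r" using root_reflection[OF r] by metis
    have "inj_on g (edges v)" using symmetry_inj[OF g(1)] by (metis inj_on_subset subset_UNIV)
    then have "?s = (\<Sum>w\<in>edges v. g w)"
      using sum.reindex[of g "edges v" "\<lambda>w. w"] edges_image[OF g(1), of v] g(2) by simp
    also have "\<dots> = g ?s" by (simp add: linear_sum[OF symmetry_linear[OF g(1)]])
    finally have "?s \<bullet> r = - (?s \<bullet> r)" using symmetry_inner[OF g(1), of ?s r] g(3) by simp
    then show ?thesis by simp
  qed
  then obtain t where t: "?s = t *\<^sub>R v" using orthogonal_to_roots[OF v] by metis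
  have "t * (v \<bullet> v) = ?s \<bullet> v" by (simp only: t inner_scaleR_left)
  also have "\<dots> = (\<Sum>w\<in>edges v. w \<bullet> v)" by (rule inner_sum_left)
  also have "\<dots> \<le> 0"
  proof (rule sum_nonpos)
    fix w assume "w \<in> edges v"
    then obtain u where "u \<in> nbrs v" "w = u - v" by (auto simp: edges_def)
    then show "w \<bullet> v \<le> 0" using inner_nbr_less[of u v] by (simp add: inner_diff_left inner_commute[of u v])
  qed
  finally have "t \<le> 0" using vertex_nonzero[OF v] mult_le_cancel_right[of t "v \<bullet> v" 0] by simp
  then show ?thesis using that[of "- t"] t by simp
qed

end

section \<open>The double cone\<close>

definition orthonormal_pair :: "'a::real_inner \<Rightarrow> 'a \<Rightarrow> bool" where
  "orthonormal_pair a b \<longleftrightarrow> a \<bullet> a = 1 \<and> b \<bullet> b = 1 \<and> a \<bullet> b = 0"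

text \<open>This is \<open>Pc\<close> after an orthogonal map, with \<open>a\<close> and
  \<open>b\<close> the first two rows of its matrix.\<close>

definition complex_form :: "'a::real_inner \<Rightarrow> 'a \<Rightarrow> 'a \<Rightarrow> complex" where
  "complex_form a b w = Complex (a \<bullet> w) (b \<bullet> w)"

lemma complex_form_diff: "complex_form a b (x - y) = complex_form a b x - complex_form a b y"
  by (simp add: complex_form_def inner_diff_right complex_eq_iff)

lemma complex_form_scale: "complex_form a b (c *\<^sub>R x) = of_real c * complex_form a b x"
  by (simp add: complex_form_def complex_eq_iff)

lemma complex_form_sum: "complex_form a b (\<Sum>w\<in>S. f w) = (\<Sum>w\<in>S. complex_form a b (f w))"
  by (simp add: complex_form_def complex_eq_iff inner_sum_right)

lemma Pc_inner:
  "Pc y = Complex (y \<bullet> axis (enum_class.enum ! 0) 1) (y \<bullet> axis (enum_class.enum ! 1) 1)"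
  by (simp add: Pc_def inner_axis)

lemma orthonormal_pair_axes:
  assumes "2 \<le> CARD('m::enum)"
  shows "orthonormal_pair (axis (enum_class.enum ! 0) 1 :: real^('m::enum)) (axis (enum_class.enum ! 1) 1)"
proof -
  have "length (enum_class.enum :: 'm list) = CARD('m)" by (simp add: card_UNIV_length_enum)
  then have "(enum_class.enum ! 0 :: 'm) \<noteq> enum_class.enum ! 1"
    using nth_eq_iff_index_eq[OF enum_distinct[where ?'a='m], of 0 1] assms by auto
  then show ?thesis by (simp add: orthonormal_pair_def inner_axis_axis)
qed

lemma Pc_orthogonal_transformation:
  fixes A :: "real^('m::enum) \<Rightarrow> real^('m::enum)"
  assumes A: "orthogonal_transformation A" and "2 \<le> CARD('m)"
  obtains a b where "orthonormal_pair a b" "\<And>w. Pc (A w) = complex_form a b w"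
proof -
  let ?e = "axis (enum_class.enum ! 0) 1 :: real^('m::enum)" and ?f = "axis (enum_class.enum ! 1) 1 :: real^('m::enum)"
  note inv = orthogonal_transformation_inner[OF orthogonal_transformation_inv[OF A]]
  have A_inv: "A w \<bullet> x = inv A x \<bullet> w" for w x
    using orthogonal_transformation_inner[OF A, of w "inv A x"]
      surj_f_inv_f[OF orthogonal_transformation_surj[OF A], of x] by (simp add: inner_commute)
  show ?thesis
  proof (rule that)
    show "orthonormal_pair (inv A ?e) (inv A ?f)"
      using orthonormal_pair_axes[OF assms(2)] by (simp add: orthonormal_pair_def inv)
    show "Pc (A w) = complex_form (inv A ?e) (inv A ?f) w" for w
      by (simp add: Pc_inner complex_form_def A_inv)
  qed
qed

text \<open>Any orthonormal pair occurs as two rows: \<open>B\<close> moves \<open>a\<close> to the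
  first axis, then the reflection \<open>R\<close> along \<open>d\<close> moves the image of
  \<open>b\<close> to the second axis and fixes the first, which is orthogonal to
  \<open>d\<close>.\<close>

lemma orthonormal_pair_realised:
  fixes a b :: "real^('m::enum)"
  assumes ab: "orthonormal_pair a b" and "2 \<le> CARD('m)"
  obtains A :: "real^('m::enum) \<Rightarrow> real^('m::enum)" where "orthogonal_transformation A" "\<And>w. Pc (A w) = complex_form a b w"
proof -
  obtain e f :: "real^('m::enum)" where ef: "orthonormal_pair e f" and Pc: "\<And>y. Pc y = Complex (y \<bullet> e) (y \<bullet> f)"
    using orthonormal_pair_axes[OF assms(2)] Pc_inner by blast
  have "norm a = norm e" using ab ef by (simp add: orthonormal_pair_def norm_eq_sqrt_inner)
  then obtain B where B: "orthogonal_transformation B" "B a = e"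
    using orthogonal_transformation_exists by metis
  define d where "d = B b - f"
  \<comment> \<open>For \<open>d = 0\<close> division by zero gives \<open>k = 0\<close>, so
    \<open>R\<close> is then the identity, as required.\<close>
  define k where "k = 2 / (d \<bullet> d)"
  define R where "R x = x - ((x \<bullet> d) * k) *\<^sub>R d" for x
  have k: "k * (k * (d \<bullet> d)) = 2 * k" by (cases "d = 0") (simp_all add: k_def)
  have "linear R"
    by (intro linearI) (simp_all add: R_def algebra_simps)
  moreover have "R x \<bullet> R y = x \<bullet> y" for x y
  proof -
    have "R x \<bullet> R y = x \<bullet> y - (x \<bullet> d) * (y \<bullet> d) * (2 * k) + (x \<bullet> d) * (y \<bullet> d) * (k * (k * (d \<bullet> d)))"
      by (simp add: R_def inner_commute[of d y] algebra_simps)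
    then show ?thesis by (simp add: k)
  qed
  ultimately have R: "orthogonal_transformation R" by (simp add: orthogonal_transformation_def)
  have Bb: "B b \<bullet> B b = 1" "e \<bullet> B b = 0"
    using ab orthogonal_transformation_inner[OF B(1), of b b] orthogonal_transformation_inner[OF B(1), of a b] B(2)
    by (simp_all add: orthonormal_pair_def)
  have "e \<bullet> d = 0" using Bb ef by (simp add: d_def inner_diff_right orthonormal_pair_def)
  then have Re: "R e = e" by (simp add: R_def)
  have "2 * (B b \<bullet> d) = d \<bullet> d"
    using Bb ef by (simp add: d_def inner_diff_left inner_diff_right orthonormal_pair_def inner_commute[of f "B b"])
  then have "(B b \<bullet> d) * k = 1" if "d \<noteq> 0" using that by (simp add: k_def field_simps)
  then have "R (B b) = B b - d" by (cases "d = 0") (simp_all add: R_def)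
  then have Rf: "R (B b) = f" by (simp add: d_def)
  note RB = orthogonal_transformation_compose[OF R B(1)]
  show ?thesis
  proof (rule that[of "R \<circ> B"], rule RB)
    fix w
    have "(R \<circ> B) w \<bullet> e = a \<bullet> w" "(R \<circ> B) w \<bullet> f = b \<bullet> w"
      using orthogonal_transformation_inner[OF RB, of w a] orthogonal_transformation_inner[OF RB, of w b] B(2) Re Rf
      by (simp_all add: inner_commute)
    then show "Pc ((R \<circ> B) w) = complex_form a b w" by (simp only: Pc complex_form_def)
  qed
qed

text \<open>The equation at \<open>x\<close> involves \<gamma> only through its value at
  \<open>x\<close>, so by choice the weights can be sought vertex by vertex.\<close>

lemma invariant_framework_iff:
  fixes X :: "(real^('m::enum)) set"
  assumes "2 \<le> CARD('m)"
  shows "invariant_framework X E \<longleftrightarrow>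
    (\<forall>x\<in>X. \<exists>g. \<forall>a b. orthonormal_pair a b \<longrightarrow>
      complex_of_real (g / real (card {y\<in>X. E x y})) * (\<Sum>y\<in>{y\<in>X. E x y}. complex_form a b (y - x))\<^sup>2
        = (\<Sum>y\<in>{y\<in>X. E x y}. (complex_form a b (y - x))\<^sup>2))"
    (is "_ \<longleftrightarrow> (\<forall>x\<in>X. \<exists>g. \<forall>a b. orthonormal_pair a b \<longrightarrow> ?eq x g a b)")
proof -
  let ?eqA = "\<lambda>x g (A :: real^('m::enum) \<Rightarrow> real^('m::enum)). let \<phi> = (\<lambda>v. Pc (A v)); Nb = {y\<in>X. E x y}; n = card Nb in
           complex_of_real (g / real n) * (\<Sum>y\<in>Nb. \<phi> y - \<phi> x)\<^sup>2
             = (\<Sum>y\<in>Nb. (\<phi> x - \<phi> y)\<^sup>2)"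
  have eq: "?eqA x g A = ?eq x g a b" if "\<And>w. Pc (A w) = complex_form a b w" for x g a b and A :: "real^('m::enum) \<Rightarrow> real^('m::enum)"
    unfolding Let_def that by (simp add: complex_form_diff power2_commute)
  have "(\<forall>A :: real^('m::enum) \<Rightarrow> real^('m::enum). orthogonal_transformation A \<longrightarrow> ?eqA x g A) \<longleftrightarrow> (\<forall>a b. orthonormal_pair a b \<longrightarrow> ?eq x g a b)" for x g
  proof (intro iffI allI impI)
    fix a b :: "real^('m::enum)"
    assume h: "\<forall>A :: real^('m::enum) \<Rightarrow> real^('m::enum). orthogonal_transformation A \<longrightarrow> ?eqA x g A" and ab: "orthonormal_pair a b"
    obtain A :: "real^('m::enum) \<Rightarrow> real^('m::enum)" where A: "orthogonal_transformation A" "\<And>w. Pc (A w) = complex_form a b w"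
      using orthonormal_pair_realised[OF ab assms] by metis
    have "?eqA x g A" using h A(1) by blast
    then show "?eq x g a b" by (simp only: eq[OF A(2)])
  next
    fix A :: "real^('m::enum) \<Rightarrow> real^('m::enum)"
    assume h: "\<forall>a b. orthonormal_pair a b \<longrightarrow> ?eq x g a b" and A: "orthogonal_transformation A"
    obtain a b where ab: "orthonormal_pair a b" "\<And>w. Pc (A w) = complex_form a b w"
      using Pc_orthogonal_transformation[OF A assms] by metis
    have "?eq x g a b" using h ab(1) by blast
    then show "?eqA x g A" by (simp only: eq[OF ab(2)])
  qed
  note this[symmetric]
  moreover have "invariant_framework X E \<longleftrightarrow>
      (\<exists>\<gamma>. \<forall>x\<in>X. \<forall>A :: real^('m::enum) \<Rightarrow> real^('m::enum). orthogonal_transformation A \<longrightarrow> ?eqA x (\<gamma> x) A)"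
    unfolding invariant_framework_def by blast
  ultimately show ?thesis by (simp only: bchoice_iff)
qed

section \<open>Coordinates of the cone space\<close>

definition drop_last :: "real^('n::finite + unit) \<Rightarrow> real^'n" where
  "drop_last y = (\<chi> j. y $ Inl j)"

lemma inner_cone_space:
  fixes x y :: "real^('n::finite + unit)"
  shows "x \<bullet> y = drop_last x \<bullet> drop_last y + x $ Inr () * y $ Inr ()"
  unfolding inner_vec_def drop_last_def UNIV_Plus_UNIV[symmetric]
  by (simp add: sum.Plus UNIV_unit)

lemma drop_last_embed [simp]: "drop_last (embed_hyp u) = u" "embed_hyp u $ Inr () = 0"
  and drop_last_apex [simp]: "drop_last (apex c) = 0" "apex c $ Inr () = c"
  by (simp_all add: drop_last_def embed_hyp_def apex_def vec_eq_iff)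

lemma embed_hyp_eq_iff [simp]: "embed_hyp u = embed_hyp v \<longleftrightarrow> u = v"
  by (metis drop_last_embed(1))

lemma apex_eq_iff [simp]: "apex b = apex c \<longleftrightarrow> b = c"
  by (metis drop_last_apex(2))

lemma embed_hyp_neq_apex [simp]:
  assumes "c \<noteq> 0" shows "embed_hyp u \<noteq> apex c" "apex c \<noteq> embed_hyp u"
  using assms by (metis drop_last_apex(2) drop_last_embed(2))+

text \<open>The horizontal part of a complex form on the cone space determines, by orthonormality,
  the square of its value on the axis.\<close>

lemma sum_complex_form_squares:
  fixes a b :: "real^('n::finite + unit)"
  assumes ab: "orthonormal_pair a b"
    and S: "\<And>x y. moment S x y = c * (x \<bullet> y) + k * ((v \<bullet> x) * (v \<bullet> y))"
  shows "(\<Sum>w\<in>S. (complex_form a b (embed_hyp w))\<^sup>2)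
    = of_real k * (complex_form a b (embed_hyp v))\<^sup>2 - of_real c * (Complex (a $ Inr ()) (b $ Inr ()))\<^sup>2"
proof -
  define \<alpha> \<beta> where "\<alpha> = drop_last a" "\<beta> = drop_last b"
  have form: "complex_form a b (embed_hyp w) = Complex (w \<bullet> \<alpha>) (w \<bullet> \<beta>)" for w
    by (simp add: complex_form_def inner_cone_space \<alpha>_\<beta>_def inner_commute)
  have sq: "(Complex s t)\<^sup>2 = Complex (s * s - t * t) (2 * (s * t))" for s t
    by (simp add: power2_eq_square complex_eq_iff)
  have on: "\<alpha> \<bullet> \<alpha> = 1 - a $ Inr () * a $ Inr ()" "\<beta> \<bullet> \<beta> = 1 - b $ Inr () * b $ Inr ()" "\<alpha> \<bullet> \<beta> = - (a $ Inr () * b $ Inr ())"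
    using ab by (simp_all add: orthonormal_pair_def inner_cone_space \<alpha>_\<beta>_def)
  have "(\<Sum>w\<in>S. (complex_form a b (embed_hyp w))\<^sup>2)
      = Complex (moment S \<alpha> \<alpha> - moment S \<beta> \<beta>) (2 * moment S \<alpha> \<beta>)"
    by (simp add: form sq moment_def complex_eq_iff sum_subtractf sum_distrib_left)
  \<comment> \<open>By orthonormality the real and imaginary parts of the horizontal scalar part are
    minus those of the squared axis value, whence the term \<open>- of_real c\<close>.\<close>
  also have "\<dots> = of_real k * (complex_form a b (embed_hyp v))\<^sup>2 - of_real c * (Complex (a $ Inr ()) (b $ Inr ()))\<^sup>2"
    unfolding form sq S on by (simp add: complex_eq_iff algebra_simps)
  finally show ?thesis .
qed

lemma embed_hyp_diff: "embed_hyp (u - v) = embed_hyp u - embed_hyp v"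
  by (simp add: embed_hyp_def vec_eq_iff split: sum.split)

lemma embed_hyp_zero: "embed_hyp 0 = 0"
  by (simp add: embed_hyp_def vec_eq_iff split: sum.split)

lemma embed_hyp_scale: "embed_hyp (c *\<^sub>R u) = c *\<^sub>R embed_hyp u"
  by (simp add: embed_hyp_def vec_eq_iff split: sum.split)

lemma embed_hyp_sum: "embed_hyp (\<Sum>w\<in>S. f w) = (\<Sum>w\<in>S. embed_hyp (f w))"
  by (simp add: embed_hyp_def vec_eq_iff split: sum.split)

lemma complex_form_apex: "complex_form a b (apex c) = of_real c * Complex (a $ Inr ()) (b $ Inr ())"
  by (simp add: complex_form_def inner_cone_space complex_eq_iff mult.commute)

section \<open>The invariance equation on the double cone\<close>

locale regular_polytope_vec = regular_polytope P for P :: "(real^('n::enum)) set set"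
begin

lemma cone_nbrs_vertex:
  assumes "b > 0" "v \<in> \<Union>P"
  shows "{y \<in> cone_vertices P b. cone_edge P b (embed_hyp v) y} = embed_hyp ` nbrs v \<union> {apex b, apex (- b)}"
  using assms nbrs_subset[of v]
  by (auto simp: cone_vertices_def cone_edge_def nbrs_def)

lemma cone_nbrs_apex:
  assumes "b > 0" "c \<in> {b, - b}"
  shows "{y \<in> cone_vertices P b. cone_edge P b (apex c) y} = embed_hyp ` \<Union>P"
  using assms by (auto simp: cone_vertices_def cone_edge_def)

lemma sum_cone_nbrs_vertex:
  fixes f :: "_ \<Rightarrow> 'c::comm_monoid_add"
  assumes "b > 0" "v \<in> \<Union>P"
  shows "(\<Sum>y\<in>{y \<in> cone_vertices P b. cone_edge P b (embed_hyp v) y}. f (y - embed_hyp v))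
    = (\<Sum>w\<in>edges v. f (embed_hyp w)) + (f (apex b - embed_hyp v) + f (apex (- b) - embed_hyp v))"
proof -
  have "(\<Sum>y\<in>embed_hyp ` nbrs v \<union> {apex b, apex (- b)}. f (y - embed_hyp v))
    = (\<Sum>y\<in>embed_hyp ` nbrs v. f (y - embed_hyp v)) + (\<Sum>y\<in>{apex b, apex (- b)}. f (y - embed_hyp v))"
    using assms by (intro sum.union_disjoint) (auto simp: finite_nbrs)
  also have "(\<Sum>y\<in>embed_hyp ` nbrs v. f (y - embed_hyp v)) = (\<Sum>w\<in>edges v. f (embed_hyp w))"
    by (simp add: edges_def sum.reindex inj_on_def embed_hyp_diff)
  also have "(\<Sum>y\<in>{apex b, apex (- b)}. f (y - embed_hyp v)) = f (apex b - embed_hyp v) + f (apex (- b) - embed_hyp v)"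
    using assms by simp
  finally show ?thesis by (simp only: cone_nbrs_vertex[OF assms])
qed

lemma card_cone_nbrs_vertex:
  assumes "b > 0" "v \<in> \<Union>P"
  shows "card {y \<in> cone_vertices P b. cone_edge P b (embed_hyp v) y} > 0"
  unfolding cone_nbrs_vertex[OF assms] by (simp add: card_gt_0_iff finite_nbrs)

text \<open>An apex sees all polytope vertices. These sum to zero and have a scalar second moment,
  so both sides are multiples of the square of the axis value \<open>L\<close>; equating the two
  coefficients gives the weight \<open>g\<close>, as \<open>n\<close> and \<open>c\<close> are
  nonzero.\<close>

lemma apex_condition:
  assumes b: "b > 0" and c: "c \<in> {b, - b}"
  shows "\<exists>g. \<forall>a d. orthonormal_pair a d \<longrightarrow>
      complex_of_real (g / real (card {y\<in>cone_vertices P b. cone_edge P b (apex c) y}))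
        * (\<Sum>y\<in>{y\<in>cone_vertices P b. cone_edge P b (apex c) y}. complex_form a d (y - apex c))\<^sup>2
      = (\<Sum>y\<in>{y\<in>cone_vertices P b. cone_edge P b (apex c) y}. (complex_form a d (y - apex c))\<^sup>2)"
proof -
  define n where "n = real (card (\<Union>P))"
  have n: "n > 0" using finite_vertices vertices_nonempty by (simp add: n_def card_gt_0_iff)
  obtain m where m: "\<And>x y. moment (\<Union>P) x y = m * (x \<bullet> y)" using vertex_moment by metis
  define g where "g = (n * c\<^sup>2 - m) / (n * c\<^sup>2)"
  have "c \<noteq> 0" using b c by auto
  have card: "card (embed_hyp ` \<Union>P) = card (\<Union>P)" by (rule card_image) (simp add: inj_on_def)
  have "complex_of_real (g / n) * (\<Sum>y\<in>embed_hyp ` \<Union>P. complex_form a d (y - apex c))\<^sup>2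
      = (\<Sum>y\<in>embed_hyp ` \<Union>P. (complex_form a d (y - apex c))\<^sup>2)" if ad: "orthonormal_pair a d" for a d
  proof -
    define L where "L = Complex (a $ Inr ()) (d $ Inr ())"
    define z where "z u = complex_form a d (embed_hyp u)" for u
    have form: "complex_form a d (embed_hyp u - apex c) = z u - of_real c * L" for u
      by (simp add: complex_form_diff complex_form_apex z_def L_def)
    have "(\<Sum>u\<in>\<Union>P. z u) = complex_form a d (embed_hyp (\<Sum>u\<in>\<Union>P. u))"
      by (simp only: z_def embed_hyp_sum complex_form_sum)
    then have z0: "(\<Sum>u\<in>\<Union>P. z u) = 0"
      using sum_vertices by (simp add: embed_hyp_zero complex_form_def complex_eq_iff)
    have z2: "(\<Sum>u\<in>\<Union>P. (z u)\<^sup>2) = - of_real m * L\<^sup>2"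
      using sum_complex_form_squares[OF ad, of "\<Union>P" m 0 0] m by (simp add: z_def L_def)
    have "(\<Sum>y\<in>embed_hyp ` \<Union>P. complex_form a d (y - apex c)) = (\<Sum>u\<in>\<Union>P. z u - of_real c * L)"
      by (simp add: sum.reindex inj_on_def form)
    also have "\<dots> = - of_real n * (of_real c * L)" by (simp add: sum_subtractf z0 n_def)
    finally have s1: "(\<Sum>y\<in>embed_hyp ` \<Union>P. complex_form a d (y - apex c)) = - of_real n * (of_real c * L)" .
    have "(\<Sum>y\<in>embed_hyp ` \<Union>P. (complex_form a d (y - apex c))\<^sup>2) = (\<Sum>u\<in>\<Union>P. (z u - of_real c * L)\<^sup>2)"
      by (simp add: sum.reindex inj_on_def form)
    also have "\<dots> = (\<Sum>u\<in>\<Union>P. (z u)\<^sup>2 - 2 * (of_real c * L) * z u + (of_real c * L)\<^sup>2)"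
      by (simp add: power2_diff algebra_simps)
    also have "\<dots> = (\<Sum>u\<in>\<Union>P. (z u)\<^sup>2) - 2 * (of_real c * L) * (\<Sum>u\<in>\<Union>P. z u) + of_real n * (of_real c * L)\<^sup>2"
      by (simp add: sum.distrib sum_subtractf sum_distrib_left n_def)
    also have "\<dots> = of_real (n * c\<^sup>2 - m) * L\<^sup>2" by (simp add: z0 z2 power_mult_distrib algebra_simps)
    finally have s2: "(\<Sum>y\<in>embed_hyp ` \<Union>P. (complex_form a d (y - apex c))\<^sup>2) = of_real (n * c\<^sup>2 - m) * L\<^sup>2" .
    have "complex_of_real (g / n) * (- of_real n * (of_real c * L))\<^sup>2 = of_real (g / n * (n * c)\<^sup>2) * L\<^sup>2"
      by (simp add: power_mult_distrib)
    also have "g / n * (n * c)\<^sup>2 = n * c\<^sup>2 - m"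
      using n \<open>c \<noteq> 0\<close> by (simp add: g_def power_mult_distrib power2_eq_square)
    finally show ?thesis by (simp only: s1 s2)
  qed
  then show ?thesis unfolding cone_nbrs_apex[OF b c] card n_def[symmetric] by blast
qed

text \<open>At a vertex \<open>v\<close> of the polytope both sides are combinations of the squares of the values of the form
  on \<open>v\<close> and on the axis; the coefficient of the former can be matched by the choice of the
  weight, that of the latter only by the choice of the height.\<close>

lemma vertex_condition:
  assumes b: "b > 0" and v: "v \<in> \<Union>P"
    and k: "\<And>x y. moment (edges v) x y = c * (x \<bullet> y) + k * ((v \<bullet> x) * (v \<bullet> y))"
  shows "(\<exists>g. \<forall>a d. orthonormal_pair a d \<longrightarrow>
      complex_of_real (g / real (card {y\<in>cone_vertices P b. cone_edge P b (embed_hyp v) y}))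
        * (\<Sum>y\<in>{y\<in>cone_vertices P b. cone_edge P b (embed_hyp v) y}. complex_form a d (y - embed_hyp v))\<^sup>2
      = (\<Sum>y\<in>{y\<in>cone_vertices P b. cone_edge P b (embed_hyp v) y}. (complex_form a d (y - embed_hyp v))\<^sup>2))
    \<longleftrightarrow> 2 * b\<^sup>2 = c" (is "(\<exists>g. ?inv g) \<longleftrightarrow> _")
proof -
  define n where "n = real (card {y\<in>cone_vertices P b. cone_edge P b (embed_hyp v) y})"
  have n: "n > 0" using card_cone_nbrs_vertex[OF b v] by (simp add: n_def)
  obtain l where l: "l \<ge> 0" "(\<Sum>w\<in>edges v. w) = - (l *\<^sub>R v)" using sum_edges[OF v] by metis
  define Z where "Z a d = complex_form a d (embed_hyp v)" for a d
  define L where "L a d = Complex (a $ Inr ()) (d $ Inr ())" for a d :: "real^('n + unit)"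
  have form: "complex_form a d (apex e - embed_hyp v) = of_real e * L a d - Z a d" for a d e
    by (simp add: complex_form_diff complex_form_apex Z_def L_def)
  have s1: "(\<Sum>y\<in>{y\<in>cone_vertices P b. cone_edge P b (embed_hyp v) y}. complex_form a d (y - embed_hyp v))
      = - of_real (l + 2) * Z a d" for a d
  proof -
    have "(\<Sum>w\<in>edges v. complex_form a d (embed_hyp w)) = complex_form a d (embed_hyp (\<Sum>w\<in>edges v. w))"
      by (simp only: embed_hyp_sum complex_form_sum)
    also have "embed_hyp (\<Sum>w\<in>edges v. w) = (- l) *\<^sub>R embed_hyp v" by (simp only: l(2) scaleR_minus_left[symmetric] embed_hyp_scale)
    also have "complex_form a d \<dots> = - of_real l * Z a d" by (simp only: complex_form_scale Z_def of_real_minus)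
    finally show ?thesis
      unfolding sum_cone_nbrs_vertex[OF b v, of "complex_form a d"] form by (simp add: algebra_simps)
  qed
  have s2: "(\<Sum>y\<in>{y\<in>cone_vertices P b. cone_edge P b (embed_hyp v) y}. (complex_form a d (y - embed_hyp v))\<^sup>2)
      = of_real (k + 2) * (Z a d)\<^sup>2 + of_real (2 * b\<^sup>2 - c) * (L a d)\<^sup>2" if ad: "orthonormal_pair a d" for a d
    unfolding sum_cone_nbrs_vertex[OF b v, of "\<lambda>w. (complex_form a d w)\<^sup>2"] form
      sum_complex_form_squares[OF ad k] Z_def[symmetric] L_def[symmetric]
    by (simp add: power2_eq_square algebra_simps)
  have inv: "?inv g \<longleftrightarrow> (\<forall>a d. orthonormal_pair a d \<longrightarrow>
      of_real (g / n * (l + 2)\<^sup>2) * (Z a d)\<^sup>2 = of_real (k + 2) * (Z a d)\<^sup>2 + of_real (2 * b\<^sup>2 - c) * (L a d)\<^sup>2)" for g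
  proof -
    have lhs: "complex_of_real (g / n) * (- of_real (l + 2) * Z a d)\<^sup>2 = of_real (g / n * (l + 2)\<^sup>2) * (Z a d)\<^sup>2" for a d
      by (simp only: power_mult_distrib power2_minus of_real_mult of_real_power mult.assoc)
    show ?thesis
      unfolding s1 n_def[symmetric] lhs by (intro all_cong1 imp_cong refl) (simp only: s2)
  qed
  show ?thesis
  proof
    assume c: "2 * b\<^sup>2 = c"
    \<comment> \<open>This weight equates the coefficients of the square of \<open>Z\<close>;
      \<open>l \<ge> 0\<close> keeps the denominator nonzero.\<close>
    have "?inv (n * (k + 2) / (l + 2)\<^sup>2)" unfolding inv using n l(1) c by simp
    then show "\<exists>g. ?inv g" by blast
  next
    assume "\<exists>g. ?inv g"
    then obtain g where g: "?inv g" by blast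
    \<comment> \<open>Test pair: a horizontal unit vector orthogonal to \<open>v\<close>, and the
      axis. The form then vanishes on \<open>v\<close> and takes the value \<i> on the axis, which
      isolates the coefficient \<open>2 * b\<^sup>2 - c\<close>.\<close>
    obtain e0 where e0: "e0 \<noteq> 0" "orthogonal v e0" using orthogonal_to_vector_exists[of v] dim_ge_2 by auto
    define e where "e = (1 / norm e0) *\<^sub>R e0"
    have e: "e \<bullet> e = 1" "e \<bullet> v = 0"
      using e0 by (simp_all add: e_def orthogonal_def inner_commute dot_square_norm power2_eq_square)
    have "orthonormal_pair (embed_hyp e) (apex 1)"
      using e by (simp add: orthonormal_pair_def inner_cone_space)
    moreover have "Z (embed_hyp e) (apex 1) = 0"
      using e by (simp add: Z_def complex_form_def inner_cone_space complex_eq_iff)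
    moreover have "L (embed_hyp e) (apex 1) = \<i>" by (simp add: L_def complex_eq_iff)
    ultimately have "complex_of_real (2 * b\<^sup>2 - c) = 0" using g unfolding inv by fastforce
    then have "2 * b\<^sup>2 - c = 0" by (simp only: of_real_eq_0_iff)
    then show "2 * b\<^sup>2 = c" by simp
  qed
qed

lemma double_cone_invariant_iff:
  obtains c where "c > 0"
    "\<And>b. b > 0 \<Longrightarrow> invariant_framework (cone_vertices P b) (cone_edge P b) \<longleftrightarrow> 2 * b\<^sup>2 = c"
proof -
  obtain c where c: "c > 0"
    "\<And>v. v \<in> \<Union>P \<Longrightarrow> \<exists>k. \<forall>x y. moment (edges v) x y = c * (x \<bullet> y) + k * ((v \<bullet> x) * (v \<bullet> y))"
    using edge_moment by metis
  have card: "2 \<le> CARD('n + unit)" using dim_ge_2 by simp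
  have "invariant_framework (cone_vertices P b) (cone_edge P b) \<longleftrightarrow> 2 * b\<^sup>2 = c" if b: "b > 0" for b
  proof -
    let ?C = "\<lambda>x. \<exists>g. \<forall>a d. orthonormal_pair a d \<longrightarrow>
      complex_of_real (g / real (card {y\<in>cone_vertices P b. cone_edge P b x y}))
        * (\<Sum>y\<in>{y\<in>cone_vertices P b. cone_edge P b x y}. complex_form a d (y - x))\<^sup>2
      = (\<Sum>y\<in>{y\<in>cone_vertices P b. cone_edge P b x y}. (complex_form a d (y - x))\<^sup>2)"
    have V: "?C (embed_hyp v) \<longleftrightarrow> 2 * b\<^sup>2 = c" if v: "v \<in> \<Union>P" for v
    proof -
      obtain k where "\<And>x y. moment (edges v) x y = c * (x \<bullet> y) + k * ((v \<bullet> x) * (v \<bullet> y))" using c(2)[OF v] by blast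
      from vertex_condition[OF b v this] show ?thesis .
    qed
    have A: "?C (apex b)" "?C (apex (- b))" by (rule apex_condition[OF b]; simp)+
    have "(\<forall>x\<in>cone_vertices P b. ?C x) \<longleftrightarrow> (\<forall>v\<in>\<Union>P. ?C (embed_hyp v))"
      using A unfolding cone_vertices_def ball_Un ball_simps(9) by (simp only: ball_simps(7) ball_simps(5) simp_thms)
    also have "\<dots> \<longleftrightarrow> (\<forall>v\<in>\<Union>P. 2 * b\<^sup>2 = c)" by (rule ball_cong[OF refl V])
    also have "\<dots> \<longleftrightarrow> 2 * b\<^sup>2 = c" using vertices_nonempty by blast
    finally show ?thesis unfolding invariant_framework_iff[OF card] .
  qed
  then show ?thesis using that c(1) by blast
qed

end

theorem theorem5p2:
  fixes P :: "(real^('n::enum)) set set"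
  assumes "CARD('n) \<ge> 2"
    and "regular_polytope_centred P"
  shows "\<exists>!b. b > 0 \<and> invariant_framework (cone_vertices P b) (cone_edge P b)"
proof -
  interpret regular_polytope_vec P
    by unfold_locales (use assms in simp_all)
  obtain c where c: "c > 0"
    "\<And>b. b > 0 \<Longrightarrow> invariant_framework (cone_vertices P b) (cone_edge P b) \<longleftrightarrow> 2 * b\<^sup>2 = c"
    using double_cone_invariant_iff by metis
  show ?thesis
  proof (rule ex1I[of _ "sqrt (c / 2)"])
    show "sqrt (c / 2) > 0 \<and> invariant_framework (cone_vertices P (sqrt (c / 2))) (cone_edge P (sqrt (c / 2)))"
      using c by simp
    fix b assume b: "b > 0 \<and> invariant_framework (cone_vertices P b) (cone_edge P b)"
    then have "b\<^sup>2 = c / 2" using c(2)[of b] by simp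
    then show "b = sqrt (c / 2)" using b by (simp add: real_sqrt_unique)
  qed
qed

end
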